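(* Let $\delta\in(0,\pi/2]$ and let $f\in H^{-1/2}(\mathbb{R}^2)$ be supported in the open unit disk $\mathcal{B}=\{x\in\mathbb{R}^2:|x|<1\}$. Then $$\|\chi_\delta(D)f\|_{H^{-1/2}(\mathbb{R}^2)}\le \|R_\delta f\|_{L^2(\mathbb{R}\times\mathbb{S}^1)},$$ where $R_\delta$ is the limited angle Radon transform and $\chi_\delta(D)$ is the Fourier multiplier whose symbol is the characteristic function of the cone $\mathcal{K}_\delta=\{\xi\in\mathbb{R}^2\setminus\{0\}:\xi/|\xi|\in\mathcal{S}_\delta\}$, with $\mathcal{S}_\delta=\{(\cos\theta,\sin\theta):|\theta|\le\delta\}$.
   Context: Notation. $|\cdot|$ is the Euclidean norm on $\mathbb{R}^2$ and $\mathbb{S}^1$ is the unit circle with arclength measure. For $\delta\in(0,\pi/2]$, $\mathcal{S}_\delta=\{(\cos\theta,\sin\theta)\in\mathbb{S}^1:|\theta|\le\delta\}$, and $\chi_\delta(v)$, $v\in\mathbb{S}^1$, denotes the characteristic function of $\mathcal{S}_\delta$. For $v\in\mathbb{S}^1$, $v^\perp$ is the unit vector orthogonal to $v$ such that $\{v,v^\perp\}$ has the same orientation as the standard coordinate frame. The limited angle Radon transform of a function $f$ on $\mathbb{R}^2$ is $$R_\delta f(p,v)=\int_{\mathbb{R}}\chi_\delta(v)\,f(pv+tv^\perp)\,dt,\qquad p\in\mathbb{R},\ v\in\mathbb{S}^1 .$$ For compactly supported distributions $f$ it is understood in the extended sense determined by the Fourier slice identity: the Fourier transform of $R_\delta f(\cdot,v)$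 in $p$ is $\widehat{R_\delta f}(\tau,v)=\chi_\delta(v)\hat f(\tau v)$. Fourier conventions: $\hat f(\xi)=\int_{\mathbb{R}^2}e^{-ix\cdot\xi}f(x)\,dx$ on $\mathbb{R}^2$ and $\hat g(\tau)=\int_{\mathbb{R}}e^{-ip\tau}g(p)\,dp$ on $\mathbb{R}$. The Sobolev norm is normalized so that $H^0=L^2$ isometrically: $\|f\|_{H^{s}(\mathbb{R}^2)}^2=(2\pi)^{-2}\int_{\mathbb{R}^2}(1+|\xi|^2)^{s}|\hat f(\xi)|^2\,d\xi$. The same symbol $\chi_\delta$ also denotes the characteristic function on $\mathbb{R}^2$ of the cone $\mathcal{K}_\delta=\{\xi\in\mathbb{R}^2\setminus\{0\}:\xi/|\xi|\in\mathcal{S}_\delta\}$, i.e. $\chi_\delta(\xi)=\chi_\delta(\xi/|\xi|)$ for $\xi\ne0$. The Fourier multiplier $\chi_\delta(D)$ is defined by $\chi_\delta(D)f=(\chi_\delta\hat f)^\vee$, where ${}^\vee$ is the inverse Fourier transform. *)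

theory Defs
  imports "HOL-Analysis.Analysis"
begin

definition partials :: "'a::euclidean_space list \<Rightarrow> ('a \<Rightarrow> complex) \<Rightarrow> 'a \<Rightarrow> complex" where
  "partials bs \<phi> = foldr (\<lambda>b g x. frechet_derivative g (at x) b) bs \<phi>"

definition smooth :: "('a::euclidean_space \<Rightarrow> complex) \<Rightarrow> bool" where
  "smooth \<phi> \<longleftrightarrow> (\<forall>bs. set bs \<subseteq> Basis \<longrightarrow> (\<forall>x. partials bs \<phi> differentiable (at x)))"

definition schwartz :: "('a::euclidean_space \<Rightarrow> complex) \<Rightarrow> bool" where
  "schwartz \<phi> \<longleftrightarrow> smooth \<phi> \<and>
     (\<forall>k bs. set bs \<subseteq> Basis \<longrightarrow>
        bounded (range (\<lambda>x. complex_of_real ((1 + norm x) ^ k) * partials bs \<phi> x)))"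

definition schwartz_norm :: "nat \<Rightarrow> ('a::euclidean_space \<Rightarrow> complex) \<Rightarrow> real" where
  "schwartz_norm N \<phi> =
     (SUP (bs, x) \<in> {bs. set bs \<subseteq> Basis \<and> length bs \<le> N} \<times> UNIV.
        (1 + norm x) ^ N * norm (partials bs \<phi> x))"

text \<open>A distribution is a functional on functions of which only the values at Schwartz
  functions matter.\<close>

type_synonym 'a distribution = "('a \<Rightarrow> complex) \<Rightarrow> complex"

definition tempered :: "'a::euclidean_space distribution \<Rightarrow> bool" where
  "tempered T \<longleftrightarrow>
     (\<forall>\<phi> \<psi> a b. schwartz \<phi> \<longrightarrow> schwartz \<psi> \<longrightarrow>
        T (\<lambda>x. a * \<phi> x + b * \<psi> x) = a * T \<phi> + b * T \<psi>) \<and>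
     (\<exists>C N. \<forall>\<phi>. schwartz \<phi> \<longrightarrow> norm (T \<phi>) \<le> C * schwartz_norm N \<phi>)"

definition dist_support :: "'a::euclidean_space distribution \<Rightarrow> 'a set" where
  "dist_support T = - \<Union>{U. open U \<and>
     (\<forall>\<phi>. smooth \<phi> \<and> compact (closure {x. \<phi> x \<noteq> 0}) \<and> closure {x. \<phi> x \<noteq> 0} \<subseteq> U \<longrightarrow> T \<phi> = 0)}"

definition fun_dist :: "('a::euclidean_space \<Rightarrow> complex) \<Rightarrow> 'a distribution" where
  "fun_dist g = (\<lambda>\<phi>. \<integral>x. g x * \<phi> x \<partial>lborel)"

text \<open>The distribution \<open>T\<close> is the function \<open>g\<close>. Such a \<open>g\<close> is unique up to null sets.\<close>

definition represents :: "('a::euclidean_space \<Rightarrow> complex) \<Rightarrow> 'a distribution \<Rightarrow> bool" where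
  "represents g T \<longleftrightarrow> g \<in> borel_measurable borel \<and>
     (\<forall>\<phi>. schwartz \<phi> \<longrightarrow> integrable lborel (\<lambda>x. g x * \<phi> x) \<and> T \<phi> = fun_dist g \<phi>)"

definition fourier :: "('a::euclidean_space \<Rightarrow> complex) \<Rightarrow> 'a \<Rightarrow> complex" where
  "fourier \<phi> \<xi> = (\<integral>x. exp (- \<i> * complex_of_real (x \<bullet> \<xi>)) * \<phi> x \<partial>lborel)"

definition inv_fourier :: "('a::euclidean_space \<Rightarrow> complex) \<Rightarrow> 'a \<Rightarrow> complex" where
  "inv_fourier \<phi> x =
     complex_of_real (1 / (2 * pi) ^ DIM('a)) *
       (\<integral>\<xi>. exp (\<i> * complex_of_real (x \<bullet> \<xi>)) * \<phi> \<xi> \<partial>lborel)"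

definition fourier_dist :: "'a::euclidean_space distribution \<Rightarrow> 'a distribution" where
  "fourier_dist T = (\<lambda>\<phi>. T (fourier \<phi>))"

definition inv_fourier_dist :: "'a::euclidean_space distribution \<Rightarrow> 'a distribution" where
  "inv_fourier_dist T = (\<lambda>\<phi>. T (inv_fourier \<phi>))"

text \<open>The Fourier transform of \<open>T\<close> as a function, for \<open>T\<close> whose Fourier transform is one.
  It is determined up to null sets. A continuous representative is unique and is the one taken
  whenever it exists; for compactly supported \<open>T\<close> it does exist (it is the smooth function
  obtained by pairing \<open>T\<close> with exponentials), so that the value at each point is
  meaningful there.\<close>

definition fourier_fun :: "'a::euclidean_space distribution \<Rightarrow> 'a \<Rightarrow> complex" where
  "fourier_fun T = (SOME g. represents g (fourier_dist T) \<and>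
     ((\<exists>c. continuous_on UNIV c \<and> represents c (fourier_dist T)) \<longrightarrow> continuous_on UNIV g))"

definition fourier_multiplier ::
    "('a::euclidean_space \<Rightarrow> complex) \<Rightarrow> 'a distribution \<Rightarrow> 'a distribution" where
  "fourier_multiplier m T = inv_fourier_dist (fun_dist (\<lambda>\<xi>. m \<xi> * fourier_fun T \<xi>))"

text \<open>Norms of distributions take values in the extended half-line. They are infima over the
  functions representing the (Fourier transform of the) distribution: those agree almost
  everywhere and so have a common norm, and if there is none the norm is \<open>\<infinity>\<close>.\<close>

definition ennreal_sqrt :: "ennreal \<Rightarrow> ennreal" where
  "ennreal_sqrt a = (if a = \<infinity> then \<infinity> else ennreal (sqrt (enn2real a)))"

definition sobolev_norm :: "real \<Rightarrow> 'a::euclidean_space distribution \<Rightarrow> ennreal" where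
  "sobolev_norm s T = (INF g \<in> {g. represents g (fourier_dist T)}.
     ennreal_sqrt (ennreal (1 / (2 * pi) ^ DIM('a)) *
       (\<integral>\<^sup>+\<xi>. ennreal ((1 + (norm \<xi>)\<^sup>2) powr s * (norm (g \<xi>))\<^sup>2) \<partial>lborel)))"

definition sobolev_space :: "real \<Rightarrow> 'a::euclidean_space distribution set" where
  "sobolev_space s = {T. tempered T \<and> sobolev_norm s T < \<infinity>}"

definition circle_point :: "real \<Rightarrow> real^2" where
  "circle_point \<theta> = vector [cos \<theta>, sin \<theta>]"

definition arclength :: "(real^2) measure" where
  "arclength =
     distr (restrict_space lborel {-pi<..pi}) (restrict_space borel (sphere 0 1)) circle_point"

definition arc :: "real \<Rightarrow> (real^2) set" where
  "arc \<delta> = circle_point ` {-\<delta>..\<delta>}"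

definition angular_cone :: "real \<Rightarrow> (real^2) set" where
  "angular_cone \<delta> = {\<xi>. \<xi> \<noteq> 0 \<and> \<xi> /\<^sub>R norm \<xi> \<in> arc \<delta>}"

text \<open>The limited angle Radon transform of a compactly supported distribution \<open>f\<close>, as the
  family over \<open>v\<close> of the tempered distributions in \<open>p\<close> whose Fourier transforms are
  \<open>\<tau> \<mapsto> indicator (arc \<delta>) v * fourier_fun f (\<tau> *\<^sub>R v)\<close> (Fourier slice identity).
  If \<open>f\<close> is an integrable function this is its integral over the line
  \<open>p v + t w\<close> (\<open>t\<close> real, \<open>w\<close> the unit normal of \<open>v\<close>)
  for \<open>v\<close> in the arc, and \<open>0\<close> for other \<open>v\<close>.\<close>

definition limited_radon :: "real \<Rightarrow> (real^2) distribution \<Rightarrow> real^2 \<Rightarrow> real distribution" where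
  "limited_radon \<delta> f v =
     inv_fourier_dist (fun_dist (\<lambda>\<tau>. indicator (arc \<delta>) v * fourier_fun f (\<tau> *\<^sub>R v)))"

text \<open>The \<open>L\<^sup>2\<close> norm over line times circle of a family \<open>u\<close> of distributions on the line
  indexed by the points of the circle: \<open>u\<close> is the function \<open>h\<close> if \<open>u v\<close> is
  \<open>h (\<cdot>, v)\<close> for almost every \<open>v\<close>.\<close>

definition L2_norm_line_circle :: "(real^2 \<Rightarrow> real distribution) \<Rightarrow> ennreal" where
  "L2_norm_line_circle u =
     (INF h \<in> {h. h \<in> borel_measurable (lborel \<Otimes>\<^sub>M arclength) \<and>
                 (AE v in arclength. represents (\<lambda>p. h (p, v)) (u v))}.
        ennreal_sqrt (\<integral>\<^sup>+z. ennreal ((norm (h z))\<^sup>2) \<partial>(lborel \<Otimes>\<^sub>M arclength)))"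

end

theory Submission
  imports Defs "HOL-Probability.Characteristic_Functions"
begin

text \<open>Let \<open>F\<close> be the function that represents the Fourier transform of \<open>f\<close>. By
  Fourier inversion, the multiplier has Fourier transform \<open>\<chi> F\<close>. In polar coordinates the
  Jacobian \<open>\<bar>r\<bar>\<close> is absorbed by the weight \<open>(1 + r\<^sup>2) powr (- 1 / 2)\<close>, so the
  left-hand side is bounded by the \<open>L\<^sup>2\<close> norms of \<open>F\<close> on the lines through the origin
  with direction in the arc. For almost every such direction, the slice of the Radon transform has
  the restriction of \<open>F\<close> to the line as its Fourier transform, and Plancherel in one
  variable compares the two.

  Plancherel is needed only as an inequality, which follows by duality from test functions
  \<open>t exp (- t\<^sup>2 / 2) T t\<close> with \<open>T\<close> a trigonometric polynomial. These vanish at the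
  origin, like the Jacobian, and this makes the pairing with \<open>F\<close> on a line absolutely convergent
  for almost every direction.\<close>

section \<open>Schwartz functions\<close>

text \<open>An identity of distributions on a line can be tested only on Schwartz functions, and
  nothing is known in advance about the size of F on an individual line, which is a null set of the
  plane. What the plane provides is that F times a Gaussian is integrable; read in polar
  coordinates, this controls F times \<open>hermite1\<close> on almost every line. The test
  functions are tailored to this. They are also explicit enough that their Fourier transforms are
  visibly Schwartz, so that they may be inserted in \<open>represents\<close>, and rich enough,
  since the trigonometric factors approximate every bounded measurable \<kappa>. The duality is run
  with the additive bound \<open>(A + B) / 2\<close> instead of a product of two norms. This form
  passes to limits without square roots and, for the optimal \<kappa>, B coincides with the
  left-hand side and can be absorbed. The inequality has room to spare: the normalisation
  \<open>1 / (2 * pi)\<^sup>2\<close> of the plane meets only one factor \<open>2 * pi\<close> from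
  Plancherel on lines, and a half circle of directions is compared with the whole circle.\<close>

lemma partials_Nil [simp]: "partials [] \<phi> = \<phi>"
  by (simp add: partials_def)

lemma partials_Cons:
  "partials (b # bs) \<phi> = (\<lambda>x. frechet_derivative (partials bs \<phi>) (at x) b)"
  by (simp add: partials_def)

text \<open>\<open>foldr\<close> applies the last direction first: snoc differentiates \<phi>
  itself, while Cons adds the outermost derivative. The partials of a derivative are therefore
  partials of the function, without any symmetry of mixed derivatives.\<close>

lemma partials_snoc:
  "partials (bs @ [b]) \<phi> = partials bs (\<lambda>x. frechet_derivative \<phi> (at x) b)"
  by (simp add: partials_def)

lemma schwartz_deriv:
  assumes "schwartz \<phi>" "b \<in> Basis"
  shows "schwartz (\<lambda>x. frechet_derivative \<phi> (at x) b)"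
proof -
  have "set (bs @ [b]) \<subseteq> Basis" if "set bs \<subseteq> Basis" for bs
    using that assms(2) by auto
  then show ?thesis
    using assms(1) unfolding schwartz_def smooth_def partials_snoc[symmetric] by blast
qed

lemma schwartz_differentiable:
  assumes "schwartz \<phi>"
  shows "\<phi> differentiable (at x)"
  using assms unfolding schwartz_def smooth_def
  by (metis partials_Nil empty_set empty_subsetI)

lemma schwartz_has_derivative:
  "schwartz \<phi> \<Longrightarrow> (\<phi> has_derivative frechet_derivative \<phi> (at x)) (at x)"
  using schwartz_differentiable frechet_derivative_works by blast

lemma schwartz_continuous:
  "schwartz \<phi> \<Longrightarrow> continuous_on UNIV \<phi>"
  by (simp add: continuous_at_imp_continuous_on differentiable_imp_continuous_within
      schwartz_differentiable)

lemma schwartz_measurable: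
  "schwartz \<phi> \<Longrightarrow> \<phi> \<in> borel_measurable borel"
  by (simp add: borel_measurable_continuous_onI schwartz_continuous)

lemma schwartz_decay:
  assumes "schwartz \<phi>"
  obtains C where "\<And>x. (1 + norm x) ^ k * norm (\<phi> x) \<le> C"
proof -
  have "bounded (range (\<lambda>x. complex_of_real ((1 + norm x) ^ k) * partials [] \<phi> x))"
    using assms unfolding schwartz_def by (metis empty_set empty_subsetI)
  then obtain C where "\<And>x. norm (complex_of_real ((1 + norm x) ^ k) * \<phi> x) \<le> C"
    by (auto simp: bounded_iff)
  moreover have "norm (complex_of_real ((1 + norm x) ^ k) * \<phi> x) = (1 + norm x) ^ k * norm (\<phi> x)" for x
    unfolding norm_mult norm_of_real by simp
  ultimately show ?thesis
    using that by metis
qed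

text \<open>Smoothness is what makes \<open>frechet_derivative\<close> linear here: at a point where
  a function is not differentiable its value is an unspecified choice.\<close>

lemma partials_lincomb:
  assumes "smooth \<phi>" "smooth \<psi>" "set bs \<subseteq> Basis"
  shows "partials bs (\<lambda>x. a * \<phi> x + c * \<psi> x) = (\<lambda>x. a * partials bs \<phi> x + c * partials bs \<psi> x)"
  using assms(3)
proof (induction bs)
  case (Cons b bs)
  show ?case
  proof
    fix x
    have d: "(partials bs \<phi> has_derivative frechet_derivative (partials bs \<phi>) (at x)) (at x)"
      "(partials bs \<psi> has_derivative frechet_derivative (partials bs \<psi>) (at x)) (at x)"
      using assms(1,2) Cons.prems unfolding smooth_def frechet_derivative_works by auto
    have "((\<lambda>x. a * partials bs \<phi> x + c * partials bs \<psi> x) has_derivative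
        (\<lambda>h. a * frechet_derivative (partials bs \<phi>) (at x) h +
             c * frechet_derivative (partials bs \<psi>) (at x) h)) (at x)"
      by (intro derivative_intros d)
    then show "partials (b # bs) (\<lambda>x. a * \<phi> x + c * \<psi> x) x =
        a * partials (b # bs) \<phi> x + c * partials (b # bs) \<psi> x"
      using Cons by (simp add: partials_Cons frechet_derivative_at[symmetric])
  qed
qed simp

lemma schwartz_lincomb:
  assumes "schwartz \<phi>" "schwartz \<psi>"
  shows "schwartz (\<lambda>x. a * \<phi> x + c * \<psi> x)"
proof -
  have s: "smooth \<phi>" "smooth \<psi>"
    using assms by (auto simp: schwartz_def)
  have "partials bs (\<lambda>x. a * \<phi> x + c * \<psi> x) differentiable at x" if "set bs \<subseteq> Basis" for bs x
    using s that by (simp add: partials_lincomb smooth_def)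
  moreover have "bounded (range (\<lambda>x. complex_of_real ((1 + norm x) ^ k) *
      partials bs (\<lambda>x. a * \<phi> x + c * \<psi> x) x))" if bs: "set bs \<subseteq> Basis" for k bs
  proof -
    let ?w = "\<lambda>x::'a. complex_of_real ((1 + norm x) ^ k)"
    have "bounded (range (\<lambda>x. ?w x * partials bs \<phi> x))"
      "bounded (range (\<lambda>x. ?w x * partials bs \<psi> x))"
      using assms bs by (auto simp: schwartz_def)
    then have "bounded (range (\<lambda>x. a * (?w x * partials bs \<phi> x)))"
      "bounded (range (\<lambda>x. c * (?w x * partials bs \<psi> x)))"
      using bounded_linear_image[OF _ bounded_linear_mult_right] by (fastforce simp: image_image)+
    from bounded_plus_comp[OF this] show ?thesis
      unfolding partials_lincomb[OF s bs] by (simp add: algebra_simps)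
  qed
  ultimately show ?thesis
    by (simp add: schwartz_def smooth_def)
qed

section \<open>Integrability from polynomial decay\<close>

lemma integrable_one_over_one_plus_square: "integrable lborel (\<lambda>x::real. 1 / (1 + x\<^sup>2))"
proof -
  have "set_integrable lborel (einterval (-\<infinity>) \<infinity>) (\<lambda>x::real. 1 / (1 + x\<^sup>2))"
  proof (rule interval_integral_FTC_nonneg(1)[where F=arctan and A="-pi/2" and B="pi/2"])
    show "DERIV arctan x :> 1 / (1 + x\<^sup>2)" for x
      using DERIV_arctan[of x] by (simp add: field_simps)
    show "isCont (\<lambda>x. 1 / (1 + x\<^sup>2)) x" for x :: real
      by (intro continuous_intros) (metis add_pos_nonneg less_numeral_extra(1,3) zero_le_power2)
    show "((arctan \<circ> real_of_ereal) \<longlongrightarrow> -pi/2) (at_right (-\<infinity>))"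
      "((arctan \<circ> real_of_ereal) \<longlongrightarrow> pi/2) (at_left \<infinity>)"
      using tendsto_arctan_at_bot tendsto_arctan_at_top
      by (auto simp: ereal_tendsto_simps)
  qed auto
  then show ?thesis
    by (simp add: set_integrable_def)
qed

text \<open>Comparison with the product over the coordinates of the integrable functions
  \<open>1 / (1 + s\<^sup>2)\<close>. Each coordinate is at most \<open>norm x\<close> in absolute
  value, so every factor costs two powers of \<open>1 + norm x\<close>; hence the exponent
  \<open>2 * DIM('a)\<close>.\<close>

lemma integrable_decay:
  "integrable lborel (\<lambda>x::'a::euclidean_space. 1 / (1 + norm x) ^ (2 * DIM('a)))"
proof -
  let ?f = "\<lambda>x::'a. \<Prod>b\<in>Basis. 1 / (1 + (x \<bullet> b)\<^sup>2)"
  have "(\<integral>\<^sup>+x. ennreal (1 / (1 + x\<^sup>2)) \<partial>lborel) < \<infinity>"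
    using integrable_one_over_one_plus_square by (simp add: real_integrable_def top.not_eq_extremum)
  then have "(\<Prod>b\<in>(Basis::'a set). \<integral>\<^sup>+x. ennreal (1 / (1 + x\<^sup>2)) \<partial>lborel) < \<infinity>"
    by (simp add: power_less_top_ennreal)
  moreover have "(\<integral>\<^sup>+x. ennreal (?f x) \<partial>lborel) = (\<integral>\<^sup>+x. (\<Prod>b\<in>(Basis::'a set). ennreal (1 / (1 + (x \<bullet> b)\<^sup>2))) \<partial>lborel)"
    by (intro nn_integral_cong) (simp add: prod_ennreal)
  moreover have "\<dots> = (\<Prod>b\<in>(Basis::'a set). \<integral>\<^sup>+x. ennreal (1 / (1 + x\<^sup>2)) \<partial>lborel)"
    by (rule nn_integral_lborel_prod) auto
  ultimately have "(\<integral>\<^sup>+x. ennreal (?f x) \<partial>lborel) < \<infinity>"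
    by simp
  then have "integrable lborel ?f"
    by (intro integrableI_nonneg) (auto intro!: prod_nonneg)
  then show ?thesis
  proof (rule Bochner_Integration.integrable_bound)
    show "AE x in lborel. norm (1 / (1 + norm x) ^ (2 * DIM('a))) \<le> norm (?f x)"
    proof (rule AE_I2)
      fix x :: 'a
      have "1 + (x \<bullet> b)\<^sup>2 \<le> (1 + norm x)\<^sup>2" if "b \<in> Basis" for b
      proof -
        have "(x \<bullet> b)\<^sup>2 \<le> (norm x)\<^sup>2"
          using Basis_le_norm[OF that, of x] by (simp add: abs_le_square_iff[symmetric])
        moreover have "(1 + norm x)\<^sup>2 = 1 + (norm x)\<^sup>2 + 2 * norm x"
          by (simp add: power2_sum)
        ultimately show ?thesis
          using norm_ge_zero[of x] by linarith
      qed
      then have "(\<Prod>b\<in>(Basis::'a set). 1 / (1 + norm x)\<^sup>2) \<le> ?f x"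
        by (intro prod_mono conjI frac_le) (auto simp: add_pos_nonneg)
      moreover have "(\<Prod>b\<in>(Basis::'a set). 1 / (1 + norm x)\<^sup>2) = 1 / (1 + norm x) ^ (2 * DIM('a))"
        by (simp add: power_one_over power_mult)
      moreover have "0 \<le> ?f x"
        by (intro prod_nonneg) auto
      ultimately show "norm (1 / (1 + norm x) ^ (2 * DIM('a))) \<le> norm (?f x)"
        by simp
    qed
  qed simp
qed

lemma integrable_of_decay:
  fixes f :: "'a::euclidean_space \<Rightarrow> 'b::{banach, second_countable_topology}"
  assumes "f \<in> borel_measurable borel"
    and "\<And>x. (1 + norm x) ^ (2 * DIM('a)) * norm (f x) \<le> C"
  shows "integrable lborel f"
proof (rule Bochner_Integration.integrable_bound)
  show "integrable lborel (\<lambda>x::'a. C * (1 / (1 + norm x) ^ (2 * DIM('a))))"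
    using integrable_decay by (rule integrable_mult_right)
  have "norm (f x) \<le> C * (1 / (1 + norm x) ^ (2 * DIM('a)))" for x
    using assms(2)[of x] by (simp add: field_simps add_pos_nonneg)
  then show "AE x in lborel. norm (f x) \<le> norm (C * (1 / (1 + norm x) ^ (2 * DIM('a))))"
    by (intro AE_I2) (metis abs_ge_self order_trans real_norm_def)
qed (use assms in simp)

lemma schwartz_integrable: "schwartz \<phi> \<Longrightarrow> integrable lborel \<phi>"
  by (metis integrable_of_decay schwartz_decay schwartz_measurable)

text \<open>By translation invariance every difference quotient of g has integral zero, so that no
  iterated integrals or boundary terms arise. The mean value inequality and the decay of the
  derivative supply the integrable majorant for the limit.\<close>

lemma integral_derivative_eq_0:
  fixes g :: "'a::euclidean_space \<Rightarrow> complex"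
  assumes b: "b \<in> Basis"
    and g: "integrable lborel g"
    and D: "\<And>x. (g has_derivative D x) (at x)"
    and decay: "\<And>x. (1 + norm x) ^ (2 * DIM('a)) * norm (D x b) \<le> C"
  shows "(\<integral>x. D x b \<partial>lborel) = 0"
proof -
  let ?k = "2 * DIM('a)"
  define t :: "nat \<Rightarrow> real" where "t n = inverse (real (Suc n))" for n
  define q where "q n x = (g (x + t n *\<^sub>R b) - g x) / t n" for n x
  have t: "0 < t n" "t n \<le> 1" for n
    by (auto simp: t_def field_simps)
  have g_meas [measurable]: "g \<in> borel_measurable borel"
    using g by auto
  have lim: "(\<lambda>n. q n x) \<longlonglongrightarrow> D x b" for x
  proof -
    have "((\<lambda>s. g (x + s *\<^sub>R b)) has_derivative (\<lambda>s. D x (s *\<^sub>R b))) (at 0)"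
      by (rule has_derivative_compose[of "\<lambda>s. x + s *\<^sub>R b" "\<lambda>s. s *\<^sub>R b"])
        (auto intro!: derivative_eq_intros D simp: D)
    moreover have "(\<lambda>s. D x (s *\<^sub>R b)) = (\<lambda>s. s *\<^sub>R D x b)"
      using D[of x] by (simp add: has_derivative_bounded_linear linear_simps)
    ultimately have "((\<lambda>s. g (x + s *\<^sub>R b)) has_vector_derivative D x b) (at 0)"
      by (simp add: has_vector_derivative_def)
    then have "((\<lambda>s. norm (g (x + s *\<^sub>R b) - g x - s *\<^sub>R D x b) / norm s) \<longlongrightarrow> 0) (at 0)"
      by (simp add: has_vector_derivative_def has_derivative_at)
    moreover have "norm (g (x + s *\<^sub>R b) - g x - s *\<^sub>R D x b) / norm s =
        norm ((g (x + s *\<^sub>R b) - g x) /\<^sub>R s - D x b)" if "s \<noteq> 0" for s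
    proof -
      have "(g (x + s *\<^sub>R b) - g x) /\<^sub>R s - D x b = (g (x + s *\<^sub>R b) - g x - s *\<^sub>R D x b) /\<^sub>R s"
        using that by (simp add: scaleR_diff_right)
      then show ?thesis
        by (simp add: divide_inverse_commute)
    qed
    ultimately have "((\<lambda>s. norm ((g (x + s *\<^sub>R b) - g x) /\<^sub>R s - D x b)) \<longlongrightarrow> 0) (at 0)"
      by (elim Lim_transform_eventually) (auto simp: eventually_at_filter)
    then have "((\<lambda>s. (g (x + s *\<^sub>R b) - g x) /\<^sub>R s) \<longlongrightarrow> D x b) (at 0)"
      by (rule LIM_zero_cancel[OF tendsto_norm_zero_cancel])
    moreover have "t \<longlonglongrightarrow> 0"
      unfolding t_def[abs_def] by (rule LIMSEQ_inverse_real_of_nat)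
    then have "filterlim t (at 0) sequentially"
      using t(1) by (simp add: filterlim_at less_imp_neq[symmetric])
    ultimately have "(\<lambda>n. (g (x + t n *\<^sub>R b) - g x) /\<^sub>R t n) \<longlonglongrightarrow> D x b"
      by (rule filterlim_compose)
    then show ?thesis
      by (simp add: q_def scaleR_conv_of_real divide_inverse_commute)
  qed
  have bound: "norm (q n x) \<le> C * 2 ^ ?k * (1 / (1 + norm x) ^ ?k)" for n x
  proof -
    have "\<exists>s\<in>{0<..<t n}. norm (g (x + t n *\<^sub>R b) - g (x + 0 *\<^sub>R b)) \<le> norm (D (x + s *\<^sub>R b) ((t n - 0) *\<^sub>R b))"
    proof (rule mvt_general[OF t(1)])
      show d: "((\<lambda>s. g (x + s *\<^sub>R b)) has_derivative (\<lambda>h. D (x + s *\<^sub>R b) (h *\<^sub>R b))) (at s)" for s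
        by (rule has_derivative_compose[of "\<lambda>s. x + s *\<^sub>R b" "\<lambda>s. s *\<^sub>R b"])
          (auto intro!: derivative_eq_intros D simp: D)
      show "continuous_on {0..t n} (\<lambda>s. g (x + s *\<^sub>R b))"
        using d by (meson continuous_at_imp_continuous_on has_derivative_continuous)
    qed
    then obtain s where s: "0 < s" "s < t n"
      and le: "norm (g (x + t n *\<^sub>R b) - g x) \<le> norm (D (x + s *\<^sub>R b) (t n *\<^sub>R b))"
      by auto
    have "D (x + s *\<^sub>R b) (t n *\<^sub>R b) = t n *\<^sub>R D (x + s *\<^sub>R b) b"
      using D[of "x + s *\<^sub>R b"] by (simp add: has_derivative_bounded_linear linear_simps)
    with le t(1)[of n] have "norm (q n x) \<le> norm (D (x + s *\<^sub>R b) b)"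
      by (simp add: q_def norm_divide field_simps)
    \<comment> \<open>The steps \<open>t n\<close> are at most 1, so the intermediate point lies at
      distance less than 1 from x; this is the source of the factor \<open>2 ^ ?k\<close> in the
      majorant.\<close>
    moreover have "1 + norm x \<le> 2 * (1 + norm (x + s *\<^sub>R b))"
    proof -
      have "norm x \<le> norm (x + s *\<^sub>R b) + s"
        using norm_triangle_ineq4[of "x + s *\<^sub>R b" "s *\<^sub>R b"] s b by simp
      then show ?thesis
        using s t(2)[of n] norm_ge_zero[of "x + s *\<^sub>R b"] by argo
    qed
    then have "(1 + norm x) ^ ?k \<le> 2 ^ ?k * (1 + norm (x + s *\<^sub>R b)) ^ ?k"
      by (metis (no_types) add_nonneg_nonneg norm_ge_zero power_mono power_mult_distrib zero_le_one)
    ultimately have "(1 + norm x) ^ ?k * norm (q n x) \<le>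
        2 ^ ?k * (1 + norm (x + s *\<^sub>R b)) ^ ?k * norm (D (x + s *\<^sub>R b) b)"
      by (intro mult_mono) auto
    also have "\<dots> \<le> 2 ^ ?k * C"
      using decay[of "x + s *\<^sub>R b"] by (simp add: mult.assoc)
    finally show ?thesis
      by (simp add: field_simps add_pos_nonneg)
  qed
  have int_shift: "integrable lborel (\<lambda>x. g (x + t n *\<^sub>R b))"
    "(\<integral>x. g (x + t n *\<^sub>R b) \<partial>lborel) = (\<integral>x. g x \<partial>lborel)" for n
  proof -
    have *: "integrable (distr lborel borel ((+) (t n *\<^sub>R b))) g"
      using g by (simp add: lborel_distr_plus)
    show "integrable lborel (\<lambda>x. g (x + t n *\<^sub>R b))"
      using * by (subst (asm) integrable_distr_eq) (auto simp: add.commute)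
    have "(\<integral>x. g x \<partial>lborel) = (\<integral>x. g x \<partial>(distr lborel borel ((+) (t n *\<^sub>R b))))"
      by (simp add: lborel_distr_plus)
    also have "\<dots> = (\<integral>x. g (x + t n *\<^sub>R b) \<partial>lborel)"
      by (subst integral_distr) (auto simp: add.commute)
    finally show "(\<integral>x. g (x + t n *\<^sub>R b) \<partial>lborel) = (\<integral>x. g x \<partial>lborel)" ..
  qed
  have "(\<integral>x. q n x \<partial>lborel) = 0" for n
    using int_shift[of n] g by (simp add: q_def)
  moreover have "(\<lambda>n. \<integral>x. q n x \<partial>lborel) \<longlonglongrightarrow> (\<integral>x. D x b \<partial>lborel)"
  proof (rule integral_dominated_convergence)
    show "integrable lborel (\<lambda>x::'a. C * 2 ^ ?k * (1 / (1 + norm x) ^ ?k))"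
      using integrable_decay by (rule integrable_mult_right)
    show q_meas: "q n \<in> borel_measurable lborel" for n
      unfolding q_def by measurable
    show "(\<lambda>x. D x b) \<in> borel_measurable lborel"
      using q_meas lim by (rule borel_measurable_LIMSEQ_metric)
  qed (use lim bound in auto)
  ultimately show ?thesis
    by (simp add: LIMSEQ_const_iff)
qed

section \<open>Polynomials times Gaussians\<close>

text \<open>Polynomials are described by closure rules because only their stability under
  differentiation and their growth matter. Inner products with arbitrary vectors make the derivative
  of a Gaussian exponent, in any direction, a member of the class.\<close>

inductive poly_fun :: "('a::euclidean_space \<Rightarrow> complex) \<Rightarrow> bool" where
  const: "poly_fun (\<lambda>x. c)"
| inner: "poly_fun (\<lambda>x. complex_of_real (x \<bullet> v))"
| add: "poly_fun p \<Longrightarrow> poly_fun q \<Longrightarrow> poly_fun (\<lambda>x. p x + q x)"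
| mult: "poly_fun p \<Longrightarrow> poly_fun q \<Longrightarrow> poly_fun (\<lambda>x. p x * q x)"

lemma poly_fun_has_derivative:
  assumes "poly_fun p"
  obtains D where "\<And>x. (p has_derivative D x) (at x)" "\<And>v. poly_fun (\<lambda>x. D x v)"
proof -
  have "\<exists>D. (\<forall>x. (p has_derivative D x) (at x)) \<and> (\<forall>v. poly_fun (\<lambda>x. D x v))"
    using assms
  proof induction
    case (const c)
    show ?case
      by (rule exI[of _ "\<lambda>x h. 0"]) (auto intro: poly_fun.const)
  next
    case (inner v)
    show ?case
      by (rule exI[of _ "\<lambda>x h. complex_of_real (h \<bullet> v)"])
        (auto intro!: poly_fun.const derivative_eq_intros)
  next
    case (add p q)
    then obtain D E where
      "\<And>x. (p has_derivative D x) (at x)" "\<And>v. poly_fun (\<lambda>x. D x v)"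
      "\<And>x. (q has_derivative E x) (at x)" "\<And>v. poly_fun (\<lambda>x. E x v)"
      by blast
    then show ?case
      by (intro exI[of _ "\<lambda>x h. D x h + E x h"]) (auto intro!: poly_fun.add derivative_eq_intros)
  next
    case (mult p q)
    then obtain D E where
      "\<And>x. (p has_derivative D x) (at x)" "\<And>v. poly_fun (\<lambda>x. D x v)"
      "\<And>x. (q has_derivative E x) (at x)" "\<And>v. poly_fun (\<lambda>x. E x v)"
      by blast
    then show ?case
      using mult.hyps
      by (intro exI[of _ "\<lambda>x h. p x * E x h + D x h * q x"])
        (auto intro!: poly_fun.add poly_fun.mult has_derivative_mult)
  qed
  then show ?thesis
    using that by blast
qed

lemma poly_fun_growth:
  assumes "poly_fun p"
  obtains C k where "\<And>x. norm (p x) \<le> C * (1 + norm x) ^ k" "C \<ge> 0"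
proof -
  have "\<exists>C k. C \<ge> 0 \<and> (\<forall>x. norm (p x) \<le> C * (1 + norm x) ^ k)"
    using assms
  proof induction
    case (const c)
    show ?case
      by (rule exI[of _ "norm c"], rule exI[of _ 0]) auto
  next
    case (inner v)
    have "norm (complex_of_real (x \<bullet> v)) \<le> norm v * (1 + norm x) ^ 1" for x
      using Cauchy_Schwarz_ineq2[of x v] by (simp add: algebra_simps add_increasing)
    then show ?case
      by (meson norm_ge_zero)
  next
    case (add p q)
    then obtain C k D l where *: "C \<ge> 0" "D \<ge> 0" "\<And>x. norm (p x) \<le> C * (1 + norm x) ^ k"
      "\<And>x. norm (q x) \<le> D * (1 + norm x) ^ l"
      by blast
    have "norm (p x + q x) \<le> (C + D) * (1 + norm x) ^ max k l" for x
    proof -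
      have "norm (p x) \<le> C * (1 + norm x) ^ max k l"
        by (rule order_trans[OF *(3)[of x]]) (use * in \<open>auto intro!: mult_left_mono power_increasing\<close>)
      moreover have "norm (q x) \<le> D * (1 + norm x) ^ max k l"
        by (rule order_trans[OF *(4)[of x]]) (use * in \<open>auto intro!: mult_left_mono power_increasing\<close>)
      ultimately show ?thesis
        using norm_triangle_ineq[of "p x" "q x"] by (simp add: algebra_simps)
    qed
    moreover have "C + D \<ge> 0"
      using * by simp
    ultimately show ?case
      by blast
  next
    case (mult p q)
    then obtain C k D l where *: "C \<ge> 0" "D \<ge> 0" "\<And>x. norm (p x) \<le> C * (1 + norm x) ^ k"
      "\<And>x. norm (q x) \<le> D * (1 + norm x) ^ l"
      by blast
    have "norm (p x * q x) \<le> (C * D) * (1 + norm x) ^ (k + l)" for x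
    proof -
      have "norm (p x * q x) \<le> (C * (1 + norm x) ^ k) * (D * (1 + norm x) ^ l)"
        unfolding norm_mult using * by (intro mult_mono) auto
      then show ?thesis
        by (simp add: power_add mult_ac)
    qed
    moreover have "C * D \<ge> 0"
      using * by simp
    ultimately show ?case
      by blast
  qed
  then show ?thesis
    using that by blast
qed

text \<open>The parameter a moves the centre: for \<open>b = 0\<close> this is the standard Gaussian
  centred at a, times \<open>exp ((a \<bullet> a) / 2)\<close>. The parameter b is a modulation. The
  Fourier transform turns modulations into translations, so both are needed to have the test
  functions and their transforms in one family.\<close>

definition gauss :: "'a::euclidean_space \<Rightarrow> 'a \<Rightarrow> 'a \<Rightarrow> complex" where
  "gauss a b x = exp (complex_of_real (x \<bullet> a - (x \<bullet> x) / 2) + \<i> * complex_of_real (x \<bullet> b))"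

lemma gauss_has_derivative:
  "(gauss a b has_derivative
     (\<lambda>h. (complex_of_real (h \<bullet> a) - complex_of_real (x \<bullet> h) + \<i> * complex_of_real (h \<bullet> b)) * gauss a b x)) (at x)"
proof -
  have "((\<lambda>x. complex_of_real (x \<bullet> a - (x \<bullet> x) / 2) + \<i> * complex_of_real (x \<bullet> b)) has_derivative
     (\<lambda>h. complex_of_real (h \<bullet> a - (x \<bullet> h + h \<bullet> x) / 2) + \<i> * complex_of_real (h \<bullet> b))) (at x)"
    by (auto intro!: derivative_eq_intros)
  from has_derivative_compose[OF this DERIV_exp[unfolded has_field_derivative_def]] show ?thesis
    unfolding gauss_def by (simp add: inner_commute mult.commute)
qed

lemma norm_gauss: "norm (gauss a b x) = exp (x \<bullet> a - (norm x)\<^sup>2 / 2)"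
  by (simp add: gauss_def norm_exp_eq_Re power2_norm_eq_inner)

lemma power_le_fact_exp:
  assumes "0 \<le> (y::real)"
  shows "y ^ k \<le> fact k * exp y"
proof -
  have "sum (\<lambda>n. y ^ n /\<^sub>R fact n) {k} \<le> (\<Sum>n. y ^ n /\<^sub>R fact n)"
    using assms by (intro sum_le_suminf summable_exp_generic) auto
  then show ?thesis
    by (simp add: exp_def field_simps)
qed

lemma gauss_decay:
  obtains C where "\<And>x. (1 + norm x) ^ k * norm (gauss a b x) \<le> C"
proof
  fix x :: 'a
  \<comment> \<open>Completing the square with this s absorbs both \<open>x \<bullet> a\<close> and
    an extra \<open>norm x\<close> into half the square of the norm; the extra term leaves the decay
    \<open>exp (- norm x)\<close>.\<close>
  define s where "s = norm a + 1"
  have "x \<bullet> a \<le> norm x * norm a"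
    by (rule norm_cauchy_schwarz)
  moreover have "0 \<le> (norm x - s)\<^sup>2"
    by simp
  ultimately have "x \<bullet> a - (norm x)\<^sup>2 / 2 \<le> s\<^sup>2 / 2 - norm x"
    by (simp add: s_def power2_diff power2_sum algebra_simps)
  then have "norm (gauss a b x) \<le> exp (s\<^sup>2 / 2 - norm x)"
    by (simp add: norm_gauss)
  moreover have "(1 + norm x) ^ k \<le> fact k * exp (1 + norm x)"
    by (rule power_le_fact_exp) simp
  ultimately have "(1 + norm x) ^ k * norm (gauss a b x) \<le> (fact k * exp (1 + norm x)) * exp (s\<^sup>2 / 2 - norm x)"
    by (intro mult_mono) auto
  also have "\<dots> = fact k * exp (1 + s\<^sup>2 / 2)"
    by (simp add: mult.assoc exp_add[symmetric])
  finally show "(1 + norm x) ^ k * norm (gauss a b x) \<le> fact k * exp (1 + (norm a + 1)\<^sup>2 / 2)"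
    by (simp add: s_def)
qed

text \<open>The logarithmic derivative of the Gaussian (\<open>L\<close> below) is affine in x, so
  every partial derivative is again a polynomial times the same Gaussian, and the Gaussian decay
  beats polynomial growth.\<close>

lemma schwartz_poly_gauss:
  assumes "poly_fun p"
  shows "schwartz (\<lambda>x. p x * gauss a b x)"
proof -
  have step: "\<exists>r. poly_fun r \<and> (\<lambda>x. q x * gauss a b x) differentiable (at x) \<and>
      (\<lambda>x. frechet_derivative (\<lambda>x. q x * gauss a b x) (at x) v) = (\<lambda>x. r x * gauss a b x)"
    if q: "poly_fun q" for q :: "'a \<Rightarrow> complex" and v x
  proof -
    obtain D where D: "\<And>x. (q has_derivative D x) (at x)" "\<And>v. poly_fun (\<lambda>x. D x v)"
      using poly_fun_has_derivative[OF q] by blast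
    define L where "L x h = complex_of_real (h \<bullet> a) - complex_of_real (x \<bullet> h) + \<i> * complex_of_real (h \<bullet> b)" for x h
    have d: "((\<lambda>x. q x * gauss a b x) has_derivative
        (\<lambda>h. q x * (L x h * gauss a b x) + D x h * gauss a b x)) (at x)" for x
      unfolding L_def by (rule has_derivative_mult[OF D(1) gauss_has_derivative])
    have "poly_fun (\<lambda>x. (complex_of_real (v \<bullet> a) + \<i> * complex_of_real (v \<bullet> b)) + (-1) * complex_of_real (x \<bullet> v))"
      by (intro poly_fun.intros)
    moreover have "(\<lambda>x. (complex_of_real (v \<bullet> a) + \<i> * complex_of_real (v \<bullet> b)) + (-1) * complex_of_real (x \<bullet> v)) = (\<lambda>x. L x v)"
      by (auto simp: L_def)
    ultimately have "poly_fun (\<lambda>x. q x * L x v + D x v)"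
      using q D(2) by (auto intro: poly_fun.intros)
    moreover have "(\<lambda>x. frechet_derivative (\<lambda>x. q x * gauss a b x) (at x) v) =
        (\<lambda>x. (q x * L x v + D x v) * gauss a b x)"
      by (simp add: frechet_derivative_at[OF d, symmetric] algebra_simps)
    moreover have "(\<lambda>x. q x * gauss a b x) differentiable (at x)"
      using d differentiable_def by blast
    ultimately show ?thesis
      by blast
  qed
  have partials: "\<exists>q. poly_fun q \<and> partials bs (\<lambda>x. p x * gauss a b x) = (\<lambda>x. q x * gauss a b x)" for bs
  proof (induction bs)
    case (Cons v bs)
    then obtain q where q: "poly_fun q" and eq: "partials bs (\<lambda>x. p x * gauss a b x) = (\<lambda>x. q x * gauss a b x)"
      by blast
    show ?case
      unfolding partials_Cons eq using step[OF q] by blast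
  qed (use assms in auto)
  have "partials bs (\<lambda>x. p x * gauss a b x) differentiable (at x)" for bs x
  proof -
    obtain q where q: "poly_fun q" and eq: "partials bs (\<lambda>x. p x * gauss a b x) = (\<lambda>x. q x * gauss a b x)"
      using partials by blast
    show ?thesis
      unfolding eq using step[OF q] by blast
  qed
  moreover have "bounded (range (\<lambda>x. complex_of_real ((1 + norm x) ^ k) *
      partials bs (\<lambda>x. p x * gauss a b x) x))" for k bs
  proof -
    obtain q where q: "poly_fun q" and eq: "partials bs (\<lambda>x. p x * gauss a b x) = (\<lambda>x. q x * gauss a b x)"
      using partials by blast
    obtain C l where C: "\<And>x. norm (q x) \<le> C * (1 + norm x) ^ l" "C \<ge> 0"
      using poly_fun_growth[OF q] by blast
    obtain B where B: "\<And>x. (1 + norm x) ^ (k + l) * norm (gauss a b x) \<le> B"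
      using gauss_decay by blast
    have "norm (complex_of_real ((1 + norm x) ^ k) * (q x * gauss a b x)) \<le> C * B" for x
    proof -
      have "norm (complex_of_real ((1 + norm x) ^ k) * (q x * gauss a b x)) =
          (1 + norm x) ^ k * (norm (q x) * norm (gauss a b x))"
        unfolding norm_mult norm_of_real by simp
      also have "\<dots> \<le> (1 + norm x) ^ k * ((C * (1 + norm x) ^ l) * norm (gauss a b x))"
        using C by (intro mult_left_mono mult_right_mono) auto
      also have "\<dots> = C * ((1 + norm x) ^ (k + l) * norm (gauss a b x))"
        by (simp add: power_add)
      also have "\<dots> \<le> C * B"
        using B C by (intro mult_left_mono)
      finally show ?thesis .
    qed
    then show ?thesis
      unfolding eq by (auto simp: bounded_iff)
  qed
  ultimately show ?thesis
    by (simp add: schwartz_def smooth_def)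
qed

section \<open>The Fourier transform of Schwartz functions\<close>

lemma integrable_unimodular_mult:
  fixes \<phi> :: "'a::euclidean_space \<Rightarrow> complex"
  assumes "integrable lborel \<phi>" "u \<in> borel_measurable borel" "\<And>x. norm (u x) = 1"
  shows "integrable lborel (\<lambda>x. u x * \<phi> x)"
  by (rule Bochner_Integration.integrable_bound[OF assms(1)])
    (use assms in \<open>auto simp: norm_mult\<close>)

lemma integrable_fourier_kernel:
  fixes \<phi> :: "'a::euclidean_space \<Rightarrow> complex"
  assumes "integrable lborel \<phi>"
  shows "integrable lborel (\<lambda>x. exp (- \<i> * complex_of_real (x \<bullet> \<xi>)) * \<phi> x)"
    and "integrable lborel (\<lambda>x. exp (\<i> * complex_of_real (x \<bullet> \<xi>)) * \<phi> x)"
  by ((rule integrable_unimodular_mult[OF assms]; simp add: norm_exp_eq_Re); fail)+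

lemma norm_fourier_le:
  fixes \<phi> :: "'a::euclidean_space \<Rightarrow> complex"
  shows "norm (fourier \<phi> \<xi>) \<le> (\<integral>x. norm (\<phi> x) \<partial>lborel)"
proof -
  have "norm (fourier \<phi> \<xi>) \<le> (\<integral>x. norm (exp (- \<i> * complex_of_real (x \<bullet> \<xi>)) * \<phi> x) \<partial>lborel)"
    unfolding fourier_def by (rule integral_norm_bound)
  then show ?thesis
    by (simp add: norm_mult norm_exp_eq_Re)
qed

lemma fourier_lincomb:
  assumes "integrable lborel \<phi>" "integrable lborel \<psi>"
  shows "fourier (\<lambda>x. a * \<phi> x + c * \<psi> x) = (\<lambda>\<xi>. a * fourier \<phi> \<xi> + c * fourier \<psi> \<xi>)"
proof
  fix \<xi>
  have "fourier (\<lambda>x. a * \<phi> x + c * \<psi> x) \<xi> =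
      (\<integral>x. a * (exp (- \<i> * complex_of_real (x \<bullet> \<xi>)) * \<phi> x) +
           c * (exp (- \<i> * complex_of_real (x \<bullet> \<xi>)) * \<psi> x) \<partial>lborel)"
    unfolding fourier_def by (intro Bochner_Integration.integral_cong) (auto simp: algebra_simps)
  also have "\<dots> = a * fourier \<phi> \<xi> + c * fourier \<psi> \<xi>"
    unfolding fourier_def
    by (simp only: integral_mult_right_zero Bochner_Integration.integral_add
        integrable_mult_right integrable_fourier_kernel(1) assms)
  finally show "fourier (\<lambda>x. a * \<phi> x + c * \<psi> x) \<xi> = a * fourier \<phi> \<xi> + c * fourier \<psi> \<xi>" .
qed

text \<open>Integration by parts: \<open>D\<close> is the derivative of the kernel times \<phi>. Its
  integral in direction b vanishes, so the two terms of the product rule cancel.\<close>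

lemma fourier_deriv:
  fixes \<phi> :: "'a::euclidean_space \<Rightarrow> complex"
  assumes "schwartz \<phi>" "b \<in> Basis"
  shows "fourier (\<lambda>x. frechet_derivative \<phi> (at x) b) \<xi> = \<i> * complex_of_real (\<xi> \<bullet> b) * fourier \<phi> \<xi>"
proof -
  let ?e = "\<lambda>x. exp (- \<i> * complex_of_real (x \<bullet> \<xi>))"
  let ?\<phi>' = "\<lambda>x. frechet_derivative \<phi> (at x)"
  define D where "D x h = ?e x * ?\<phi>' x h + (- \<i> * complex_of_real (h \<bullet> \<xi>) * ?e x) * \<phi> x" for x h
  have e: "(?e has_derivative (\<lambda>h. - \<i> * complex_of_real (h \<bullet> \<xi>) * ?e x)) (at x)" for x
  proof -
    have "((\<lambda>x. - \<i> * complex_of_real (x \<bullet> \<xi>)) has_derivative (\<lambda>h. - \<i> * complex_of_real (h \<bullet> \<xi>))) (at x)"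
      by (auto intro!: derivative_eq_intros)
    from has_derivative_compose[OF this DERIV_exp[unfolded has_field_derivative_def]]
    show ?thesis by (simp add: mult.commute)
  qed
  have D: "((\<lambda>x. ?e x * \<phi> x) has_derivative D x) (at x)" for x
    unfolding D_def by (rule has_derivative_mult[OF e schwartz_has_derivative[OF assms(1)]])
  have s': "schwartz (\<lambda>x. ?\<phi>' x b)"
    using assms by (rule schwartz_deriv)
  obtain C1 C2 where C: "\<And>x. (1 + norm x) ^ (2 * DIM('a)) * norm (?\<phi>' x b) \<le> C1"
    "\<And>x. (1 + norm x) ^ (2 * DIM('a)) * norm (\<phi> x) \<le> C2"
    using schwartz_decay[OF s'] schwartz_decay[OF assms(1)] by metis
  have "(\<integral>x. D x b \<partial>lborel) = 0"
  proof (rule integral_derivative_eq_0[OF assms(2) _ D])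
    show "integrable lborel (\<lambda>x. ?e x * \<phi> x)"
      using assms by (intro integrable_fourier_kernel schwartz_integrable)
    fix x :: 'a
    have "norm (D x b) \<le> norm (?\<phi>' x b) + \<bar>b \<bullet> \<xi>\<bar> * norm (\<phi> x)"
      unfolding D_def by (rule order_trans[OF norm_triangle_ineq]) (simp add: norm_mult norm_exp_eq_Re)
    then have "(1 + norm x) ^ (2 * DIM('a)) * norm (D x b) \<le>
        (1 + norm x) ^ (2 * DIM('a)) * (norm (?\<phi>' x b) + \<bar>b \<bullet> \<xi>\<bar> * norm (\<phi> x))"
      by (intro mult_left_mono) auto
    also have "\<dots> = (1 + norm x) ^ (2 * DIM('a)) * norm (?\<phi>' x b) +
        \<bar>b \<bullet> \<xi>\<bar> * ((1 + norm x) ^ (2 * DIM('a)) * norm (\<phi> x))"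
      by (simp add: algebra_simps)
    also have "\<dots> \<le> C1 + \<bar>b \<bullet> \<xi>\<bar> * C2"
      using C by (intro add_mono mult_left_mono) auto
    finally show "(1 + norm x) ^ (2 * DIM('a)) * norm (D x b) \<le> C1 + \<bar>b \<bullet> \<xi>\<bar> * C2" .
  qed
  moreover have "(\<integral>x. D x b \<partial>lborel) =
      fourier (\<lambda>x. ?\<phi>' x b) \<xi> + (\<integral>x. (- \<i> * complex_of_real (b \<bullet> \<xi>)) * (?e x * \<phi> x) \<partial>lborel)"
    unfolding D_def fourier_def mult.assoc[of _ "?e _" "\<phi> _"]
    by (simp only: Bochner_Integration.integral_add integrable_mult_right
        integrable_fourier_kernel(1) schwartz_integrable s' assms(1))
  moreover have "(\<integral>x. (- \<i> * complex_of_real (b \<bullet> \<xi>)) * (?e x * \<phi> x) \<partial>lborel) =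
      - \<i> * complex_of_real (\<xi> \<bullet> b) * fourier \<phi> \<xi>"
    unfolding fourier_def by (subst integral_mult_right_zero) (simp add: inner_commute)
  ultimately show ?thesis
    by simp
qed

text \<open>Each further power of \<open>norm \<xi>\<close> is bounded by the sum of the coordinates
  in absolute value, and each coordinate is traded for a derivative of \<phi>; hence the induction
  over all \<phi> at once. This controls the transform but not its derivatives. Where a transform
  itself has to be Schwartz, explicit test functions take over.\<close>

lemma fourier_decay:
  fixes \<phi> :: "'a::euclidean_space \<Rightarrow> complex"
  assumes "schwartz \<phi>"
  shows "\<exists>C. \<forall>\<xi>. (1 + norm \<xi>) ^ k * norm (fourier \<phi> \<xi>) \<le> C"
  using assms
proof (induction k arbitrary: \<phi>)
  case 0
  then show ?case
    using norm_fourier_le[of \<phi>] by auto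
next
  case (Suc k)
  let ?D = "\<lambda>b x. frechet_derivative \<phi> (at x) b"
  obtain C where C: "\<And>\<xi>. (1 + norm \<xi>) ^ k * norm (fourier \<phi> \<xi>) \<le> C"
    using Suc by blast
  have "\<forall>b\<in>Basis. \<exists>C. \<forall>\<xi>. (1 + norm \<xi>) ^ k * norm (fourier (?D b) \<xi>) \<le> C"
    using Suc.IH schwartz_deriv[OF Suc.prems] by blast
  then obtain B where B: "\<And>b \<xi>. b \<in> Basis \<Longrightarrow> (1 + norm \<xi>) ^ k * norm (fourier (?D b) \<xi>) \<le> B b"
    by metis
  have "(1 + norm \<xi>) ^ Suc k * norm (fourier \<phi> \<xi>) \<le> C + (\<Sum>b\<in>Basis. B b)" for \<xi>
  proof -
    let ?w = "(1 + norm \<xi>) ^ k"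
    have "(1 + norm \<xi>) ^ Suc k * norm (fourier \<phi> \<xi>) =
        ?w * norm (fourier \<phi> \<xi>) + norm \<xi> * (?w * norm (fourier \<phi> \<xi>))"
      by (simp add: algebra_simps)
    also have "\<dots> \<le> ?w * norm (fourier \<phi> \<xi>) + (\<Sum>b\<in>Basis. \<bar>\<xi> \<bullet> b\<bar>) * (?w * norm (fourier \<phi> \<xi>))"
      by (intro add_left_mono mult_right_mono norm_le_l1) auto
    also have "\<dots> = ?w * norm (fourier \<phi> \<xi>) + (\<Sum>b\<in>Basis. ?w * norm (fourier (?D b) \<xi>))"
      using Suc.prems by (simp add: fourier_deriv norm_mult sum_distrib_left sum_distrib_right algebra_simps)
    also have "\<dots> \<le> C + (\<Sum>b\<in>Basis. B b)"
      using B C by (intro add_mono sum_mono)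
    finally show ?thesis .
  qed
  then show ?case
    by blast
qed

lemma fourier_measurable:
  fixes \<phi> :: "'a::euclidean_space \<Rightarrow> complex"
  assumes [measurable]: "\<phi> \<in> borel_measurable borel"
  shows "fourier \<phi> \<in> borel_measurable borel"
  unfolding fourier_def[abs_def] by measurable

lemma fourier_integrable:
  fixes \<phi> :: "'a::euclidean_space \<Rightarrow> complex"
  assumes "schwartz \<phi>"
  shows "integrable lborel (fourier \<phi>)"
  using integrable_of_decay fourier_measurable[OF schwartz_measurable] fourier_decay assms by metis

section \<open>Gaussian integrals and affine changes of variable\<close>

lemma char_std_normal_integral:
  "(\<integral>s. exp (\<i> * complex_of_real (t * s)) * complex_of_real (exp (- s\<^sup>2 / 2)) \<partial>lborel) =
    complex_of_real (sqrt (2 * pi) * exp (- t\<^sup>2 / 2))"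
proof -
  have "complex_of_real (exp (- t\<^sup>2 / 2)) = (\<integral>s. std_normal_density s *\<^sub>R exp (\<i> * complex_of_real (t * s)) \<partial>lborel)"
    using fun_cong[OF char_std_normal_distribution, of t]
    by (simp add: char_def integral_density)
  also have "\<dots> = (\<integral>s. complex_of_real (1 / sqrt (2 * pi)) *
      (exp (\<i> * complex_of_real (t * s)) * complex_of_real (exp (- s\<^sup>2 / 2))) \<partial>lborel)"
    by (intro Bochner_Integration.integral_cong) (auto simp: std_normal_density_def scaleR_conv_of_real)
  finally show ?thesis
    by (simp add: field_simps)
qed

lemma std_gauss_integrable:
  "integrable lborel (\<lambda>x::'a::euclidean_space. complex_of_real (exp (- (norm x)\<^sup>2 / 2)))"
proof -
  have "integrable lborel (\<lambda>x::'a. 1 * gauss 0 0 x)"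
    by (intro schwartz_integrable schwartz_poly_gauss poly_fun.const)
  then show ?thesis
    by (simp add: gauss_def power2_norm_eq_inner flip: exp_of_real)
qed

text \<open>Lebesgue measure is the image of a product over the coordinates, and the integrand
  factors accordingly. What remains in each coordinate is the characteristic function of the
  standard normal distribution.\<close>

lemma gauss_fourier:
  fixes x :: "'a::euclidean_space"
  shows "(\<integral>\<xi>. exp (\<i> * complex_of_real (x \<bullet> \<xi>)) * complex_of_real (exp (- (norm \<xi>)\<^sup>2 / 2)) \<partial>lborel) =
    complex_of_real (sqrt (2 * pi) ^ DIM('a) * exp (- (norm x)\<^sup>2 / 2))"
proof -
  let ?T = "\<lambda>f. \<Sum>b\<in>(Basis::'a set). f b *\<^sub>R b"
  let ?h = "\<lambda>b s. exp (\<i> * complex_of_real ((x \<bullet> b) * s)) * complex_of_real (exp (- s\<^sup>2 / 2))"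
  interpret product_sigma_finite "\<lambda>_::'a. lborel :: real measure" ..
  have int: "integrable lborel (?h b)" for b :: 'a
  proof -
    have "integrable lborel (\<lambda>s. exp (\<i> * complex_of_real (s \<bullet> (x \<bullet> b))) * complex_of_real (exp (- (norm s)\<^sup>2 / 2)))"
      by (intro integrable_fourier_kernel std_gauss_integrable)
    then show ?thesis
      by (simp add: mult.commute)
  qed
  have "(\<integral>\<xi>. exp (\<i> * complex_of_real (x \<bullet> \<xi>)) * complex_of_real (exp (- (norm \<xi>)\<^sup>2 / 2)) \<partial>lborel) =
    (\<integral>f. exp (\<i> * complex_of_real (x \<bullet> ?T f)) * complex_of_real (exp (- (norm (?T f))\<^sup>2 / 2)) \<partial>(\<Pi>\<^sub>M b\<in>Basis. lborel))"
    by (subst lborel_eq, subst integral_distr) auto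
  also have "\<dots> = (\<integral>f. (\<Prod>b\<in>Basis. ?h b (f b)) \<partial>(\<Pi>\<^sub>M b\<in>Basis. lborel))"
  proof (intro Bochner_Integration.integral_cong refl)
    fix f :: "'a \<Rightarrow> real"
    have "x \<bullet> ?T f = (\<Sum>b\<in>Basis. (x \<bullet> b) * f b)"
      by (simp add: inner_sum_right mult.commute)
    moreover have "(norm (?T f))\<^sup>2 = (\<Sum>b\<in>Basis. (f b)\<^sup>2)"
      by (subst norm_sum_Pythagorean)
        (auto simp: pairwise_def orthogonal_def inner_Basis)
    ultimately show "exp (\<i> * complex_of_real (x \<bullet> ?T f)) * complex_of_real (exp (- (norm (?T f))\<^sup>2 / 2)) =
        (\<Prod>b\<in>Basis. ?h b (f b))"
      by (simp add: prod.distrib exp_sum[symmetric] sum_distrib_left sum_divide_distrib sum_negf of_real_prod[symmetric]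
          del: of_real_prod)
  qed
  also have "\<dots> = (\<Prod>b\<in>Basis. \<integral>s. ?h b s \<partial>lborel)"
    by (rule product_integral_prod) (use int in auto)
  also have "\<dots> = (\<Prod>b\<in>(Basis::'a set). complex_of_real (sqrt (2 * pi) * exp (- (x \<bullet> b)\<^sup>2 / 2)))"
    by (simp only: char_std_normal_integral)
  also have "\<dots> = complex_of_real (sqrt (2 * pi) ^ DIM('a) * exp (\<Sum>b\<in>Basis. - (x \<bullet> b)\<^sup>2 / 2))"
    by (simp only: of_real_prod[symmetric] prod.distrib prod_constant exp_sum finite_Basis)
  also have "(\<Sum>b\<in>Basis. - (x \<bullet> b)\<^sup>2 / 2) = - (norm x)\<^sup>2 / 2"
  proof -
    have "(norm x)\<^sup>2 = (\<Sum>b\<in>Basis. (x \<bullet> b)\<^sup>2)"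
      unfolding power2_norm_eq_inner by (subst euclidean_inner) (simp add: power2_eq_square)
    then show ?thesis
      by (simp add: sum_divide_distrib sum_negf)
  qed
  finally show ?thesis .
qed

lemma integral_lborel_affine:
  fixes f :: "'a::euclidean_space \<Rightarrow> 'b::{banach, second_countable_topology}"
  assumes [measurable]: "f \<in> borel_measurable borel" and c: "c > 0"
  shows "(\<integral>x. f x \<partial>lborel) = c ^ DIM('a) *\<^sub>R (\<integral>x. f (t + c *\<^sub>R x) \<partial>lborel)"
proof -
  have "(\<integral>x. f x \<partial>lborel) =
      (\<integral>x. f x \<partial>(density (distr lborel borel (\<lambda>x. t + c *\<^sub>R x)) (\<lambda>_. ennreal (c ^ DIM('a)))))"
    by (subst lborel_affine[of c t]) (use c in \<open>simp_all add: ennreal_power\<close>)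
  also have "\<dots> = (\<integral>x. c ^ DIM('a) *\<^sub>R f (t + c *\<^sub>R x) \<partial>lborel)"
    using c by (subst integral_density) (simp_all add: integral_distr)
  finally show ?thesis
    by simp
qed

lemma integrable_lborel_affine:
  fixes f :: "'a::euclidean_space \<Rightarrow> 'b::{banach, second_countable_topology}"
  assumes f: "integrable lborel f" and c: "c > 0"
  shows "integrable lborel (\<lambda>x. f (t + c *\<^sub>R x))"
proof -
  have [measurable]: "f \<in> borel_measurable borel"
    using f by auto
  have "lborel = density (distr lborel borel (\<lambda>x. t + c *\<^sub>R x)) (\<lambda>_. ennreal (c ^ DIM('a)))"
    using lborel_affine[of c t] c by (simp add: ennreal_power)
  then have "integrable (density (distr lborel borel (\<lambda>x. t + c *\<^sub>R x)) (\<lambda>_. ennreal (c ^ DIM('a)))) f"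
    using f by simp
  then have "integrable lborel (\<lambda>x. c ^ DIM('a) *\<^sub>R f (t + c *\<^sub>R x))"
    using c by (subst (asm) integrable_density) (simp_all add: integrable_distr_eq)
  then have "integrable lborel (\<lambda>x. inverse (c ^ DIM('a)) *\<^sub>R (c ^ DIM('a) *\<^sub>R f (t + c *\<^sub>R x)))"
    by (rule integrable_scaleR_right)
  then show ?thesis
    using c by simp
qed

section \<open>Fourier inversion and the Plancherel identity\<close>

lemma integrable_lborel_prod_mult:
  fixes f :: "'a::euclidean_space \<Rightarrow> complex" and g :: "'b::euclidean_space \<Rightarrow> complex"
  assumes f: "integrable lborel f" and g: "integrable lborel g"
    and [measurable]: "(\<lambda>(x, y). u x y) \<in> borel_measurable (lborel \<Otimes>\<^sub>M lborel)"
    and u: "\<And>x y. norm (u x y) = 1"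
  shows "integrable (lborel \<Otimes>\<^sub>M lborel) (\<lambda>(x, y). u x y * (f x * g y))"
proof (rule lborel_pair.Fubini_integrable)
  have [measurable]: "f \<in> borel_measurable borel" "g \<in> borel_measurable borel"
    using f g by auto
  show "(\<lambda>(x, y). u x y * (f x * g y)) \<in> borel_measurable (lborel \<Otimes>\<^sub>M lborel)"
    by measurable
  show "integrable lborel (\<lambda>x. \<integral>y. norm (case (x, y) of (x, y) \<Rightarrow> u x y * (f x * g y)) \<partial>lborel)"
    using f by (simp add: norm_mult u)
  have "integrable lborel (\<lambda>y. u x y * (f x * g y))" for x
    by (rule Bochner_Integration.integrable_bound[OF integrable_mult_right[OF g, of "f x"]])
      (auto simp: norm_mult u)
  then show "AE x in lborel. integrable lborel (\<lambda>y. case (x, y) of (x, y) \<Rightarrow> u x y * (f x * g y))"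
    by simp
qed

text \<open>The double integral behind the claim is not absolutely convergent, so a slowly decaying
  Gaussian factor is inserted (\<open>J n\<close>). Removing it gives the inversion integral by
  dominated convergence; exchanging the integrals instead turns \<open>J n\<close> into a Gaussian
  average of \<phi> that concentrates at x. The two limits are compared.\<close>

theorem fourier_inversion:
  fixes \<phi> :: "'a::euclidean_space \<Rightarrow> complex"
  assumes \<phi>: "schwartz \<phi>"
  shows "inv_fourier (fourier \<phi>) = \<phi>"
proof
  fix x :: 'a
  define \<gamma> :: "'a \<Rightarrow> complex" where "\<gamma> \<xi> = complex_of_real (exp (- (norm \<xi>)\<^sup>2 / 2))" for \<xi>
  define K where "K = complex_of_real (sqrt (2 * pi) ^ DIM('a))"
  define \<epsilon> where "\<epsilon> n = inverse (real (Suc n))" for n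
  have \<epsilon>: "\<epsilon> n > 0" for n
    by (simp add: \<epsilon>_def)
  have \<epsilon>_lim: "\<epsilon> \<longlonglongrightarrow> 0"
    unfolding \<epsilon>_def[abs_def] by (rule LIMSEQ_inverse_real_of_nat)
  have \<gamma>_int: "integrable lborel \<gamma>"
    unfolding \<gamma>_def by (rule std_gauss_integrable)
  have \<gamma>_norm: "norm (\<gamma> \<xi>) \<le> 1" for \<xi>
    by (simp add: \<gamma>_def)
  have \<gamma>_cont: "continuous_on UNIV \<gamma>"
    unfolding \<gamma>_def by (intro continuous_intros) auto
  have \<gamma>_0: "\<gamma> 0 = 1"
    by (simp add: \<gamma>_def)
  have [measurable]: "\<gamma> \<in> borel_measurable borel" "\<phi> \<in> borel_measurable borel" "fourier \<phi> \<in> borel_measurable borel"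
    using \<gamma>_int \<phi> schwartz_measurable fourier_measurable by auto
  have \<gamma>_fourier: "(\<integral>\<xi>. exp (\<i> * complex_of_real (z \<bullet> \<xi>)) * \<gamma> \<xi> \<partial>lborel) = K * \<gamma> z" for z
    unfolding \<gamma>_def K_def by (subst gauss_fourier) simp
  have \<gamma>_total: "(\<integral>\<xi>. \<gamma> \<xi> \<partial>lborel) = K"
    using \<gamma>_fourier[of 0] by (simp add: \<gamma>_0)
  obtain M where M: "\<And>y. norm (\<phi> y) \<le> M"
    using schwartz_decay[OF \<phi>, of 0] by auto
  define J where "J n = (\<integral>\<xi>. exp (\<i> * complex_of_real (x \<bullet> \<xi>)) * (\<gamma> (\<epsilon> n *\<^sub>R \<xi>) * fourier \<phi> \<xi>) \<partial>lborel)" for n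
  have "J \<longlonglongrightarrow> (\<integral>\<xi>. exp (\<i> * complex_of_real (x \<bullet> \<xi>)) * (1 * fourier \<phi> \<xi>) \<partial>lborel)"
    unfolding J_def
  proof (rule integral_dominated_convergence)
    show "integrable lborel (\<lambda>\<xi>. norm (fourier \<phi> \<xi>))"
      using fourier_integrable[OF \<phi>] by simp
    have "(\<lambda>n. \<gamma> (\<epsilon> n *\<^sub>R \<xi>)) \<longlonglongrightarrow> \<gamma> (0 *\<^sub>R \<xi>)" for \<xi>
      by (rule continuous_on_tendsto_compose[OF \<gamma>_cont])
        (use tendsto_scaleR[OF \<epsilon>_lim tendsto_const[of \<xi>]] in auto)
    then show "AE \<xi> in lborel. (\<lambda>n. exp (\<i> * complex_of_real (x \<bullet> \<xi>)) * (\<gamma> (\<epsilon> n *\<^sub>R \<xi>) * fourier \<phi> \<xi>))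
        \<longlonglongrightarrow> exp (\<i> * complex_of_real (x \<bullet> \<xi>)) * (1 * fourier \<phi> \<xi>)"
      by (intro AE_I2 tendsto_intros) (simp add: \<gamma>_0)
    show "AE \<xi> in lborel. norm (exp (\<i> * complex_of_real (x \<bullet> \<xi>)) * (\<gamma> (\<epsilon> n *\<^sub>R \<xi>) * fourier \<phi> \<xi>))
        \<le> norm (fourier \<phi> \<xi>)" for n
      by (auto simp: norm_mult intro!: mult_left_le_one_le \<gamma>_norm)
  qed measurable
  moreover have "J = (\<lambda>n. K * (\<integral>z. \<phi> (x + \<epsilon> n *\<^sub>R z) * \<gamma> z \<partial>lborel))"
  proof
    fix n
    have \<gamma>\<epsilon>_int: "integrable lborel (\<lambda>\<xi>. \<gamma> (\<epsilon> n *\<^sub>R \<xi>))"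
      using integrable_lborel_affine[OF \<gamma>_int \<epsilon>, of 0] by simp
    have "J n = (\<integral>\<xi>. (\<integral>y. exp (\<i> * complex_of_real ((x - y) \<bullet> \<xi>)) * (\<phi> y * \<gamma> (\<epsilon> n *\<^sub>R \<xi>)) \<partial>lborel) \<partial>lborel)"
      unfolding J_def
    proof (intro Bochner_Integration.integral_cong refl)
      fix \<xi> :: 'a
      have "(\<integral>y. exp (\<i> * complex_of_real ((x - y) \<bullet> \<xi>)) * (\<phi> y * \<gamma> (\<epsilon> n *\<^sub>R \<xi>)) \<partial>lborel) =
        (\<integral>y. (exp (\<i> * complex_of_real (x \<bullet> \<xi>)) * \<gamma> (\<epsilon> n *\<^sub>R \<xi>)) * (exp (- \<i> * complex_of_real (y \<bullet> \<xi>)) * \<phi> y) \<partial>lborel)"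
        by (intro Bochner_Integration.integral_cong refl)
          (simp add: inner_diff_left exp_diff exp_minus algebra_simps divide_inverse)
      then show "exp (\<i> * complex_of_real (x \<bullet> \<xi>)) * (\<gamma> (\<epsilon> n *\<^sub>R \<xi>) * fourier \<phi> \<xi>) =
        (\<integral>y. exp (\<i> * complex_of_real ((x - y) \<bullet> \<xi>)) * (\<phi> y * \<gamma> (\<epsilon> n *\<^sub>R \<xi>)) \<partial>lborel)"
        by (simp only: integral_mult_right_zero fourier_def mult.assoc)
    qed
    also have "\<dots> = (\<integral>y. (\<integral>\<xi>. exp (\<i> * complex_of_real ((x - y) \<bullet> \<xi>)) * (\<phi> y * \<gamma> (\<epsilon> n *\<^sub>R \<xi>)) \<partial>lborel) \<partial>lborel)"
      by (rule lborel_pair.Fubini_integral)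
        (rule integrable_lborel_prod_mult[OF schwartz_integrable[OF \<phi>] \<gamma>\<epsilon>_int],
          auto simp: norm_exp_eq_Re)
    also have "\<dots> = (\<integral>y. \<phi> y * (\<integral>\<xi>. exp (\<i> * complex_of_real ((x - y) \<bullet> \<xi>)) * \<gamma> (\<epsilon> n *\<^sub>R \<xi>) \<partial>lborel) \<partial>lborel)"
      by (simp only: integral_mult_right_zero[symmetric] mult.left_commute)
    \<comment> \<open>Substituting \<open>x + \<epsilon> n *\<^sub>R z\<close> for y magnifies
      around x. The Jacobian is exactly what the rescaling of \<xi> in the inner integral uses up
      below.\<close>
    also have "\<dots> = \<epsilon> n ^ DIM('a) *\<^sub>R (\<integral>z. \<phi> (x + \<epsilon> n *\<^sub>R z) *
        (\<integral>\<xi>. exp (\<i> * complex_of_real ((x - (x + \<epsilon> n *\<^sub>R z)) \<bullet> \<xi>)) * \<gamma> (\<epsilon> n *\<^sub>R \<xi>) \<partial>lborel) \<partial>lborel)"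
      by (rule integral_lborel_affine[OF _ \<epsilon>]) measurable
    also have "\<dots> = (\<integral>z. \<phi> (x + \<epsilon> n *\<^sub>R z) * (\<epsilon> n ^ DIM('a) *\<^sub>R
        (\<integral>\<xi>. exp (\<i> * complex_of_real ((- z) \<bullet> (0 + \<epsilon> n *\<^sub>R \<xi>))) * \<gamma> (0 + \<epsilon> n *\<^sub>R \<xi>) \<partial>lborel)) \<partial>lborel)"
      by (simp add: scaleR_conv_of_real mult.left_commute flip: integral_mult_right_zero)
    also have "\<dots> = (\<integral>z. \<phi> (x + \<epsilon> n *\<^sub>R z) * (\<integral>\<xi>. exp (\<i> * complex_of_real ((- z) \<bullet> \<xi>)) * \<gamma> \<xi> \<partial>lborel) \<partial>lborel)"
      by (subst integral_lborel_affine[OF _ \<epsilon>, of _ n 0, symmetric]) auto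
    also have "\<dots> = K * (\<integral>z. \<phi> (x + \<epsilon> n *\<^sub>R z) * \<gamma> z \<partial>lborel)"
      unfolding \<gamma>_fourier by (simp add: \<gamma>_def mult.left_commute flip: integral_mult_right_zero)
    finally show "J n = K * (\<integral>z. \<phi> (x + \<epsilon> n *\<^sub>R z) * \<gamma> z \<partial>lborel)" .
  qed
  moreover have "(\<lambda>n. K * (\<integral>z. \<phi> (x + \<epsilon> n *\<^sub>R z) * \<gamma> z \<partial>lborel)) \<longlonglongrightarrow> K * (\<integral>z. \<phi> x * \<gamma> z \<partial>lborel)"
  proof (intro tendsto_intros integral_dominated_convergence)
    show "integrable lborel (\<lambda>z. M * norm (\<gamma> z))"
      using \<gamma>_int by simp
    have "(\<lambda>n. \<phi> (x + \<epsilon> n *\<^sub>R z)) \<longlonglongrightarrow> \<phi> (x + 0 *\<^sub>R z)" for z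
      by (rule continuous_on_tendsto_compose[OF schwartz_continuous[OF \<phi>]])
        (use tendsto_add[OF tendsto_const[of x] tendsto_scaleR[OF \<epsilon>_lim tendsto_const[of z]]] in auto)
    then show "AE z in lborel. (\<lambda>n. \<phi> (x + \<epsilon> n *\<^sub>R z) * \<gamma> z) \<longlonglongrightarrow> \<phi> x * \<gamma> z"
      by (intro AE_I2 tendsto_intros) simp
    show "AE z in lborel. norm (\<phi> (x + \<epsilon> n *\<^sub>R z) * \<gamma> z) \<le> M * norm (\<gamma> z)" for n
      by (auto simp: norm_mult intro!: mult_right_mono M)
  qed measurable
  ultimately have "(\<integral>\<xi>. exp (\<i> * complex_of_real (x \<bullet> \<xi>)) * (1 * fourier \<phi> \<xi>) \<partial>lborel) = K * (\<integral>z. \<phi> x * \<gamma> z \<partial>lborel)"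
    by (metis LIMSEQ_unique)
  then have "(\<integral>\<xi>. exp (\<i> * complex_of_real (x \<bullet> \<xi>)) * fourier \<phi> \<xi> \<partial>lborel) = K * K * \<phi> x"
    by (simp add: \<gamma>_total mult_ac)
  \<comment> \<open>One factor K comes from the transform of the Gaussian, the other from its total
    mass; their product is the normalisation in \<open>inv_fourier\<close>.\<close>
  moreover have "K * K = complex_of_real ((2 * pi) ^ DIM('a))"
    unfolding K_def of_real_mult[symmetric] power_mult_distrib[symmetric] by simp
  ultimately show "inv_fourier (fourier \<phi>) x = \<phi> x"
    by (simp add: inv_fourier_def)
qed

lemma integrable_norm_square_of_bounded:
  fixes \<phi> :: "'a::euclidean_space \<Rightarrow> complex"
  assumes "integrable lborel \<phi>" "\<And>x. norm (\<phi> x) \<le> M"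
  shows "integrable lborel (\<lambda>x. (norm (\<phi> x))\<^sup>2)"
proof (rule Bochner_Integration.integrable_bound)
  show "integrable lborel (\<lambda>x. M * norm (\<phi> x))"
    using assms by simp
  show "AE x in lborel. norm ((norm (\<phi> x))\<^sup>2) \<le> norm (M * norm (\<phi> x))"
    using assms(2) by (auto simp: power2_eq_square abs_mult intro!: mult_right_mono order_trans[OF _ abs_ge_self])
qed (use assms in auto)

text \<open>One of the two factors is opened as an integral and the order of integration exchanged;
  the inner integral is then the conjugate of the inversion formula. Integrability of the transform
  is enough for the exchange.\<close>

theorem plancherel:
  fixes \<psi> :: "'a::euclidean_space \<Rightarrow> complex"
  assumes \<psi>: "schwartz \<psi>"
  shows "integrable lborel (\<lambda>\<xi>. (norm (fourier \<psi> \<xi>))\<^sup>2)"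
    and "(\<integral>\<xi>. (norm (fourier \<psi> \<xi>))\<^sup>2 \<partial>lborel) = (2 * pi) ^ DIM('a) * (\<integral>x. (norm (\<psi> x))\<^sup>2 \<partial>lborel)"
proof -
  let ?F = "fourier \<psi>" and ?N = "complex_of_real ((2 * pi) ^ DIM('a))"
  show "integrable lborel (\<lambda>\<xi>. (norm (?F \<xi>))\<^sup>2)"
    using fourier_integrable[OF \<psi>] norm_fourier_le by (rule integrable_norm_square_of_bounded)
  have [measurable]: "\<psi> \<in> borel_measurable borel" "?F \<in> borel_measurable borel"
    using \<psi> schwartz_measurable fourier_measurable by auto
  have inv: "(\<integral>\<xi>. exp (\<i> * complex_of_real (y \<bullet> \<xi>)) * ?F \<xi> \<partial>lborel) = ?N * \<psi> y" for y
    using fun_cong[OF fourier_inversion[OF \<psi>], of y] by (simp add: inv_fourier_def field_simps)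
  have "(\<integral>\<xi>. ?F \<xi> * cnj (?F \<xi>) \<partial>lborel) =
      (\<integral>\<xi>. (\<integral>y. exp (- \<i> * complex_of_real (y \<bullet> \<xi>)) * (\<psi> y * cnj (?F \<xi>)) \<partial>lborel) \<partial>lborel)"
    by (subst (1) fourier_def) (simp add: mult.assoc flip: integral_mult_left_zero)
  also have "\<dots> = (\<integral>y. (\<integral>\<xi>. exp (- \<i> * complex_of_real (y \<bullet> \<xi>)) * (\<psi> y * cnj (?F \<xi>)) \<partial>lborel) \<partial>lborel)"
    by (rule lborel_pair.Fubini_integral)
      (rule integrable_lborel_prod_mult[OF schwartz_integrable[OF \<psi>]],
        use fourier_integrable[OF \<psi>] in \<open>auto simp: norm_exp_eq_Re\<close>)
  also have "\<dots> = (\<integral>y. \<psi> y * (\<integral>\<xi>. cnj (exp (\<i> * complex_of_real (y \<bullet> \<xi>)) * ?F \<xi>) \<partial>lborel) \<partial>lborel)"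
    by (simp add: exp_cnj mult.left_commute flip: integral_mult_right_zero)
  also have "\<dots> = (\<integral>y. ?N * (\<psi> y * cnj (\<psi> y)) \<partial>lborel)"
    by (simp only: Bochner_Integration.integral_cnj inv) (simp add: mult.left_commute)
  also have "\<dots> = ?N * (\<integral>y. \<psi> y * cnj (\<psi> y) \<partial>lborel)"
    by (rule integral_mult_right_zero)
  finally have "complex_of_real (\<integral>\<xi>. (norm (?F \<xi>))\<^sup>2 \<partial>lborel) =
      ?N * complex_of_real (\<integral>x. (norm (\<psi> x))\<^sup>2 \<partial>lborel)"
    by (simp only: integral_complex_of_real[symmetric] complex_norm_square)
  then show "(\<integral>\<xi>. (norm (?F \<xi>))\<^sup>2 \<partial>lborel) = (2 * pi) ^ DIM('a) * (\<integral>x. (norm (\<psi> x))\<^sup>2 \<partial>lborel)"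
    by (metis of_real_eq_iff of_real_mult)
qed

section \<open>Trigonometric polynomials and duality on the line\<close>

inductive trig :: "(real \<Rightarrow> complex) \<Rightarrow> bool" where
  exp: "trig (\<lambda>t. exp (\<i> * complex_of_real (t * b)))"
| lincomb: "trig S \<Longrightarrow> trig T \<Longrightarrow> trig (\<lambda>t. a * S t + c * T t)"

lemma trig_const: "trig (\<lambda>t. c)"
  using trig.lincomb[OF trig.exp[of 0] trig.exp[of 0], of c 0] by simp

lemma trig_add: "trig S \<Longrightarrow> trig T \<Longrightarrow> trig (\<lambda>t. S t + T t)"
  using trig.lincomb[of S T 1 1] by simp

lemma trig_mult:
  assumes "trig S" "trig T"
  shows "trig (\<lambda>t. S t * T t)"
  using assms(1)
proof induction
  case (exp b)
  show ?case
    using assms(2)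
  proof induction
    case (exp b')
    then show ?case
      using trig.exp[of "b + b'"] by (simp add: exp_add[symmetric] algebra_simps)
  next
    case (lincomb S T a c)
    then show ?case
      using trig.lincomb[OF lincomb.IH, of a c] by (simp add: algebra_simps)
  qed
next
  case (lincomb S' T' a c)
  then show ?case
    using trig.lincomb[OF lincomb.IH, of a c] by (simp add: algebra_simps)
qed

lemma trig_measurable: "trig T \<Longrightarrow> T \<in> borel_measurable borel"
  by (induction rule: trig.induct) auto

lemma trig_cos: "trig (\<lambda>t. complex_of_real (cos (t * c)))"
proof -
  have "trig (\<lambda>t. (1/2) * exp (\<i> * complex_of_real (t * c)) + (1/2) * exp (\<i> * complex_of_real (t * - c)))"
    by (intro trig.intros)
  moreover have "(1/2) * exp (\<i> * complex_of_real (t * c)) + (1/2) * exp (\<i> * complex_of_real (t * - c)) =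
      complex_of_real (cos (t * c))" for t
    by (simp add: complex_eq_iff Re_exp Im_exp)
  ultimately show ?thesis
    by simp
qed

lemma trig_sin: "trig (\<lambda>t. complex_of_real (sin (t * c)))"
proof -
  have "trig (\<lambda>t. (-\<i>/2) * exp (\<i> * complex_of_real (t * c)) + (\<i>/2) * exp (\<i> * complex_of_real (t * - c)))"
    by (intro trig.intros)
  moreover have "(-\<i>/2) * exp (\<i> * complex_of_real (t * c)) + (\<i>/2) * exp (\<i> * complex_of_real (t * - c)) =
      complex_of_real (sin (t * c))" for t
    by (simp add: complex_eq_iff Re_exp Im_exp)
  ultimately show ?thesis
    by simp
qed

text \<open>The bridge from the Stone-Weierstrass theorem on the unit circle: on the circle a linear
  form is a combination of cosine and sine, and \<open>trig\<close> is closed under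
  products.\<close>

lemma trig_polynomial:
  assumes "real_polynomial_function q"
  shows "trig (\<lambda>t. complex_of_real (q (cis (t * c))))"
  using assms
proof induction
  case (linear f)
  have "f (cis s) = cos s * f 1 + sin s * f \<i>" for s
  proof -
    have "cis s = cos s *\<^sub>R 1 + sin s *\<^sub>R \<i>"
      by (simp add: complex_eq_iff)
    then have "f (cis s) = f (cos s *\<^sub>R 1 + sin s *\<^sub>R \<i>)"
      by simp
    also have "\<dots> = cos s * f 1 + sin s * f \<i>"
      using linear by (simp add: bounded_linear_def linear_add linear_cmul)
    finally show ?thesis .
  qed
  then show ?case
    using trig.lincomb[OF trig_cos trig_sin, of "complex_of_real (f 1)" c "complex_of_real (f \<i>)" c]
    by (simp add: mult.commute)
next
  case (const a)
  show ?case
    by (rule trig_const)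
next
  case (add f g)
  then show ?case
    using trig_add by simp
next
  case (mult f g)
  then show ?case
    using trig_mult by simp
qed

text \<open>The sup bound on the whole line is what the dominated convergence below needs; it comes
  from the periodicity of the approximation, which is obtained on the unit circle.\<close>

lemma trig_approx:
  fixes \<kappa> :: "real \<Rightarrow> complex"
  assumes \<kappa>: "continuous_on UNIV \<kappa>" and B: "\<And>t. norm (\<kappa> t) \<le> B"
    and L: "0 < L" "\<And>t. \<bar>t\<bar> \<ge> L \<Longrightarrow> \<kappa> t = 0"
    and "L \<le> N" "0 < e"
  obtains T where "trig T" "\<And>t. norm (T t) \<le> B + e" "\<And>t. \<bar>t\<bar> \<le> N \<Longrightarrow> norm (T t - \<kappa> t) \<le> e"
proof -
  \<comment> \<open>This carries \<kappa> to the circle, with \<open>t / N\<close> as the angle. The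
    right half circle ends at \<open>\<bar>t\<bar> = N * pi / 2\<close>, where \<kappa> already
    vanishes because \<open>L \<le> N\<close> and \<open>1 \<le> pi / 2\<close>; so the extension by
    0 to the left half is continuous. The range \<open>\<bar>t\<bar> \<le> N\<close> corresponds to
    angles of at most 1 and stays in the right half.\<close>
  define f where "f z = (if Re z \<ge> 0 then \<kappa> (N * arcsin (Im z)) else 0)" for z
  let ?S = "sphere 0 1 \<inter> {z. Re z \<ge> 0}" and ?S' = "sphere 0 1 \<inter> {z. Re z \<le> 0}"
  have N: "N > 0"
    using assms by linarith
  have Im: "-1 \<le> Im z" "Im z \<le> 1" if "z \<in> sphere 0 1" for z
    using abs_Im_le_cmod[of z] that by auto
  have cl: "closed ?S" "closed ?S'"
    using closed_halfspace_Re_ge[of 0] closed_halfspace_Re_le[of 0] by auto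
  have "continuous_on (?S \<union> ?S') f"
    unfolding f_def
  proof (rule continuous_on_cases[OF cl])
    show "continuous_on ?S (\<lambda>z. \<kappa> (N * arcsin (Im z)))"
      by (rule continuous_on_compose2[OF \<kappa>]) (use Im in \<open>auto intro!: continuous_intros\<close>)
    show "\<forall>z. z \<in> ?S \<and> \<not> 0 \<le> Re z \<or> z \<in> ?S' \<and> 0 \<le> Re z \<longrightarrow> \<kappa> (N * arcsin (Im z)) = 0"
    proof clarify
      fix z assume "z \<in> ?S \<and> \<not> 0 \<le> Re z \<or> z \<in> ?S' \<and> 0 \<le> Re z"
      then have "Re z = 0" "norm z = 1"
        by auto
      then have "\<bar>Im z\<bar> = 1"
        by (simp add: cmod_eq_Im)
      then have "\<bar>arcsin (Im z)\<bar> = pi / 2"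
        by (auto simp: abs_if arcsin_minus_1 split: if_splits)
      then have "\<bar>N * arcsin (Im z)\<bar> = N * (pi / 2)"
        using N by (simp add: abs_mult)
      moreover have "N * 1 \<le> N * (pi / 2)"
        using N pi_ge_two by (intro mult_left_mono) auto
      ultimately show "\<kappa> (N * arcsin (Im z)) = 0"
        using \<open>L \<le> N\<close> by (intro L(2)) linarith
    qed
  qed auto
  moreover have "?S \<union> ?S' = sphere 0 1"
    by auto
  ultimately have "continuous_on (sphere 0 1) f"
    by simp
  from Stone_Weierstrass_polynomial_function[OF compact_sphere this \<open>0 < e\<close>]
  obtain g where g: "polynomial_function g" "\<And>z. z \<in> sphere 0 1 \<Longrightarrow> norm (f z - g z) < e"
    by blast
  define T where "T t = g (cis (t * (1 / N)))" for t
  have close: "norm (T t - f (cis (t / N))) \<le> e" for t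
    using g(2)[of "cis (t / N)"] by (simp add: T_def norm_minus_commute less_imp_le)
  show ?thesis
  proof
    have "trig (\<lambda>t. complex_of_real ((Re \<circ> g) (cis (t * (1 / N)))))"
      "trig (\<lambda>t. complex_of_real ((Im \<circ> g) (cis (t * (1 / N)))))"
      using g(1) by (auto simp only: polynomial_function_def intro!: trig_polynomial bounded_linear_Re bounded_linear_Im)
    from trig.lincomb[OF this, of 1 \<i>] show "trig T"
      unfolding T_def by (simp add: complex_eq[symmetric])
    have "norm (f z) \<le> B" for z
      using B order_trans[OF norm_ge_zero B] by (auto simp: f_def)
    then show "norm (T t) \<le> B + e" for t
      using close[of t] norm_triangle_ineq2[of "T t" "f (cis (t / N))"] by (smt (verit))
    fix t :: real assume t: "\<bar>t\<bar> \<le> N"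
    then have "\<bar>t / N\<bar> \<le> 1"
      using N by simp
    then have t': "- (pi / 2) \<le> t / N" "t / N \<le> pi / 2"
      using pi_ge_two by linarith+
    then have "f (cis (t / N)) = \<kappa> t"
      using N cos_ge_zero[of "t / N"] by (simp add: f_def arcsin_sin)
    then show "norm (T t - \<kappa> t) \<le> e"
      using close[of t] by simp
  qed
qed

text \<open>Integrability of K and of the square of w provides majorants for both integrals once the
  \<kappa> n are uniformly bounded, so convergence almost everywhere suffices. It serves both limits
  in the extension that follows.\<close>

lemma duality_bound_limit:
  fixes K :: "real \<Rightarrow> complex" and w :: "real \<Rightarrow> real"
  assumes K: "integrable lborel K" and w: "w \<in> borel_measurable borel" "integrable lborel (\<lambda>t. (w t)\<^sup>2)"
    and \<kappa>: "\<And>n. \<kappa> n \<in> borel_measurable borel" "\<kappa>' \<in> borel_measurable borel"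
    and B: "\<And>n t. norm (\<kappa> n t) \<le> B"
    and lim: "AE t in lborel. (\<lambda>n. \<kappa> n t) \<longlonglongrightarrow> \<kappa>' t"
    and bound: "\<And>n. norm (\<integral>t. K t * \<kappa> n t \<partial>lborel) \<le> (A + (\<integral>t. (w t * norm (\<kappa> n t))\<^sup>2 \<partial>lborel)) / 2"
  shows "norm (\<integral>t. K t * \<kappa>' t \<partial>lborel) \<le> (A + (\<integral>t. (w t * norm (\<kappa>' t))\<^sup>2 \<partial>lborel)) / 2"
proof (rule LIMSEQ_le)
  have [measurable]: "K \<in> borel_measurable borel"
    using K by auto
  note [measurable] = w(1) \<kappa>
  have "(\<lambda>n. \<integral>t. K t * \<kappa> n t \<partial>lborel) \<longlonglongrightarrow> (\<integral>t. K t * \<kappa>' t \<partial>lborel)"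
  proof (rule integral_dominated_convergence)
    show "integrable lborel (\<lambda>t. norm (K t) * B)"
      using K by simp
    show "AE t in lborel. (\<lambda>n. K t * \<kappa> n t) \<longlonglongrightarrow> K t * \<kappa>' t"
      using lim by eventually_elim (intro tendsto_intros)
    show "AE t in lborel. norm (K t * \<kappa> n t) \<le> norm (K t) * B" for n
      by (auto simp: norm_mult intro!: mult_left_mono B)
  qed measurable
  then show "(\<lambda>n. norm (\<integral>t. K t * \<kappa> n t \<partial>lborel)) \<longlonglongrightarrow> norm (\<integral>t. K t * \<kappa>' t \<partial>lborel)"
    by (rule tendsto_norm)
  have "(\<lambda>n. \<integral>t. (w t * norm (\<kappa> n t))\<^sup>2 \<partial>lborel) \<longlonglongrightarrow> (\<integral>t. (w t * norm (\<kappa>' t))\<^sup>2 \<partial>lborel)"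
  proof (rule integral_dominated_convergence)
    show "integrable lborel (\<lambda>t. (w t)\<^sup>2 * B\<^sup>2)"
      using w by simp
    show "AE t in lborel. (\<lambda>n. (w t * norm (\<kappa> n t))\<^sup>2) \<longlonglongrightarrow> (w t * norm (\<kappa>' t))\<^sup>2"
      using lim by eventually_elim (intro tendsto_intros)
    show "AE t in lborel. norm ((w t * norm (\<kappa> n t))\<^sup>2) \<le> (w t)\<^sup>2 * B\<^sup>2" for n
      by (auto simp: power_mult_distrib intro!: mult_left_mono power_mono B)
  qed measurable
  then show "(\<lambda>n. (A + (\<integral>t. (w t * norm (\<kappa> n t))\<^sup>2 \<partial>lborel)) / 2) \<longlonglongrightarrow>
      (A + (\<integral>t. (w t * norm (\<kappa>' t))\<^sup>2 \<partial>lborel)) / 2"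
    by (intro tendsto_intros) auto
qed (use bound in auto)

text \<open>Two limits are taken. Continuous functions of bounded support are reached from
  trigonometric polynomials, bounded in sup norm and converging pointwise. A bounded measurable
  function is almost everywhere a limit of continuous ones, which only have to be made bounded and
  of bounded support.\<close>

lemma duality_bound_extend:
  fixes K :: "real \<Rightarrow> complex" and w :: "real \<Rightarrow> real"
  assumes K: "integrable lborel K" and w: "w \<in> borel_measurable borel" "integrable lborel (\<lambda>t. (w t)\<^sup>2)"
    and trig: "\<And>T. trig T \<Longrightarrow> norm (\<integral>t. K t * T t \<partial>lborel) \<le> (A + (\<integral>t. (w t * norm (T t))\<^sup>2 \<partial>lborel)) / 2"
    and \<kappa>: "\<kappa> \<in> borel_measurable borel" and B: "\<And>t. norm (\<kappa> t) \<le> B"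
  shows "norm (\<integral>t. K t * \<kappa> t \<partial>lborel) \<le> (A + (\<integral>t. (w t * norm (\<kappa> t))\<^sup>2 \<partial>lborel)) / 2"
proof -
  note [measurable] = w(1) \<kappa>
  have cont: "norm (\<integral>t. K t * \<mu> t \<partial>lborel) \<le> (A + (\<integral>t. (w t * norm (\<mu> t))\<^sup>2 \<partial>lborel)) / 2"
    if \<mu>: "continuous_on UNIV \<mu>" "\<And>t. norm (\<mu> t) \<le> M" "0 < L" "\<And>t. \<bar>t\<bar> \<ge> L \<Longrightarrow> \<mu> t = 0" for \<mu> :: "real \<Rightarrow> complex" and M L
  proof -
    have "\<exists>T. trig T \<and> (\<forall>t. norm (T t) \<le> M + inverse (real (Suc n))) \<and>
        (\<forall>t. \<bar>t\<bar> \<le> L + real n \<longrightarrow> norm (T t - \<mu> t) \<le> inverse (real (Suc n)))" for n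
      by (rule trig_approx[OF \<mu>, of "L + real n" "inverse (real (Suc n))"]) auto
    then obtain T where T: "\<And>n. trig (T n)" "\<And>n t. norm (T n t) \<le> M + inverse (real (Suc n))"
        "\<And>n t. \<bar>t\<bar> \<le> L + real n \<Longrightarrow> norm (T n t - \<mu> t) \<le> inverse (real (Suc n))"
      by metis
    show ?thesis
    proof (rule duality_bound_limit[OF K w])
      show "T n \<in> borel_measurable borel" for n
        using T(1) by (rule trig_measurable)
      show "\<mu> \<in> borel_measurable borel"
        using \<mu>(1) by (rule borel_measurable_continuous_onI)
      show "norm (T n t) \<le> M + 1" for n t
      proof -
        have "inverse (real (Suc n)) \<le> 1"
          by (simp add: inverse_le_1_iff)
        with T(2)[of n t] show ?thesis
          by linarith
      qed
      show "AE t in lborel. (\<lambda>n. T n t) \<longlonglongrightarrow> \<mu> t"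
      proof (rule AE_I2)
        fix t :: real
        obtain n0 where "\<bar>t\<bar> \<le> real n0"
          using real_arch_simple by blast
        then have "\<forall>\<^sub>F n in sequentially. norm (T n t - \<mu> t) \<le> inverse (real (Suc n))"
          using \<mu>(3) by (intro eventually_sequentiallyI[of n0] T(3)) auto
        then have "(\<lambda>n. T n t - \<mu> t) \<longlonglongrightarrow> 0"
          using LIMSEQ_inverse_real_of_nat by (rule Lim_null_comparison)
        then show "(\<lambda>n. T n t) \<longlonglongrightarrow> \<mu> t"
          by (rule LIM_zero_cancel)
      qed
    qed (rule trig[OF T(1)])
  qed
  have "\<kappa> measurable_on UNIV"
    using \<kappa> by (simp add: measurable_on_iff_borel_measurable lebesgue_on_UNIV_eq measurable_completion)
  then obtain N g where N: "negligible N" and g: "\<And>n. continuous_on UNIV (g n)"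
    and g_lim: "\<And>t. t \<notin> N \<Longrightarrow> (\<lambda>n. g n t) \<longlonglongrightarrow> \<kappa> t"
    unfolding measurable_on_def by auto
  \<comment> \<open>Adding 1 makes M positive even if B is 0. \<open>clip\<close> is the radial
    retraction onto the disk of radius M, hence fixes all values of \<kappa>; \<open>cut n\<close>
    is a continuous plateau that is 1 for \<open>\<bar>t\<bar> \<le> real n - 1\<close> and 0 for
    \<open>\<bar>t\<bar> \<ge> real n\<close>.\<close>
  define M where "M = B + 1"
  have M: "M > 0"
    using order_trans[OF norm_ge_zero B] by (auto simp: M_def intro: add_nonneg_pos)
  define clip where "clip z = complex_of_real (M / max M (norm z)) * z" for z
  define cut where "cut n t = max 0 (min 1 (real n - \<bar>t\<bar>))" for n and t :: real
  have clip_cont: "continuous_on UNIV clip"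
    unfolding clip_def using M by (intro continuous_intros) (auto simp: max_def)
  have clip_norm: "norm (clip z) \<le> M" for z
  proof -
    have "norm (clip z) = M * (norm z / max M (norm z))"
      using M by (simp add: clip_def norm_mult norm_divide)
    also have "norm z / max M (norm z) \<le> 1"
      using M by (simp add: divide_le_eq_1 max_def)
    finally show ?thesis
      using M by simp
  qed
  have clip_id: "clip z = z" if "norm z \<le> M" for z
    using that M by (simp add: clip_def)
  define \<mu> where "\<mu> n t = complex_of_real (cut n t) * clip (g n t)" for n t
  have \<mu>_cont: "continuous_on UNIV (\<mu> n)" for n
    unfolding \<mu>_def cut_def using g
    by (intro continuous_intros continuous_on_compose2[OF clip_cont]) auto
  have \<mu>_norm: "norm (\<mu> n t) \<le> M" for n t
  proof -
    have "norm (\<mu> n t) \<le> 1 * M"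
      unfolding \<mu>_def norm_mult by (intro mult_mono clip_norm) (auto simp: cut_def)
    then show ?thesis by simp
  qed
  show ?thesis
  proof (rule duality_bound_limit[OF K w _ \<kappa> \<mu>_norm])
    show "\<mu> n \<in> borel_measurable borel" for n
      using \<mu>_cont by (rule borel_measurable_continuous_onI)
    have "AE t in lebesgue. t \<notin> N"
      using N by (simp add: negligible_iff_null_sets AE_not_in)
    then have "AE t in lborel. t \<notin> N"
      by (simp add: AE_completion_iff)
    then show "AE t in lborel. (\<lambda>n. \<mu> n t) \<longlonglongrightarrow> \<kappa> t"
    proof eventually_elim
      case (elim t)
      have "(\<lambda>n. clip (g n t)) \<longlonglongrightarrow> clip (\<kappa> t)"
        by (rule continuous_on_tendsto_compose[OF clip_cont g_lim[OF elim]]) auto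
      moreover have "clip (\<kappa> t) = \<kappa> t"
        using B[of t] by (intro clip_id) (simp add: M_def)
      moreover obtain n0 where n0: "\<bar>t\<bar> + 1 \<le> real n0"
        using real_arch_simple by blast
      then have "\<forall>\<^sub>F n in sequentially. 1 = complex_of_real (cut n t)"
        by (intro eventually_sequentiallyI[of n0]) (auto simp: cut_def)
      then have "(\<lambda>n. complex_of_real (cut n t)) \<longlonglongrightarrow> 1"
        by (rule Lim_transform_eventually[OF tendsto_const])
      ultimately show ?case
        unfolding \<mu>_def using tendsto_mult by fastforce
    qed
    \<comment> \<open>The radius \<open>real n + 1\<close> is positive for \<open>n = 0\<close>
      too.\<close>
    show "norm (\<integral>t. K t * \<mu> n t \<partial>lborel) \<le> (A + (\<integral>t. (w t * norm (\<mu> n t))\<^sup>2 \<partial>lborel)) / 2" for n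
      by (rule cont[OF \<mu>_cont \<mu>_norm, of "real n + 1"]) (auto simp: \<mu>_def cut_def)
  qed
qed

text \<open>The first Hermite function, an eigenfunction of the Fourier transform. Its modulus at r
  is \<open>\<bar>r\<bar>\<close> times the Gaussian of the plane at distance
  \<open>\<bar>r\<bar>\<close> from the origin, so it carries the Jacobian of polar
  coordinates.\<close>

definition hermite1 :: "real \<Rightarrow> complex" where
  "hermite1 t = complex_of_real (t * exp (- t\<^sup>2 / 2))"

lemma hermite1_gauss: "hermite1 t = complex_of_real t * gauss 0 0 t"
  by (simp add: hermite1_def gauss_def power2_eq_square flip: exp_of_real)

lemma hermite1_trig_schwartz: "schwartz (\<lambda>t. hermite1 t * exp (\<i> * complex_of_real (t * b)))"
proof -
  have "schwartz (\<lambda>t::real. complex_of_real (t \<bullet> 1) * gauss 0 b t)"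
    by (intro schwartz_poly_gauss poly_fun.inner)
  moreover have "complex_of_real (t \<bullet> 1) * gauss 0 b t = hermite1 t * exp (\<i> * complex_of_real (t * b))" for t
  proof -
    have "gauss 0 b t = gauss 0 0 t * exp (\<i> * complex_of_real (t * b))"
      by (simp add: gauss_def exp_add[symmetric])
    then show ?thesis
      by (simp add: hermite1_gauss)
  qed
  ultimately show ?thesis
    by simp
qed

text \<open>The function is minus the derivative of the Gaussian, which reproduces itself up to the
  factor \<open>sqrt (2 * pi)\<close>; differentiation contributes \<open>\<i> * p\<close>.\<close>

lemma fourier_hermite1:
  "fourier hermite1 p = - \<i> * complex_of_real (sqrt (2 * pi)) * hermite1 p"
proof -
  have g: "schwartz (gauss 0 (0::real))"
    using schwartz_poly_gauss[OF poly_fun.const[of 1], of 0 "0::real"] by simp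
  \<comment> \<open>The trivial second summand gives the shape required by
    \<open>fourier_lincomb\<close>.\<close>
  have "frechet_derivative (gauss 0 0) (at t) 1 = (-1) * hermite1 t + 0 * hermite1 t" for t :: real
    by (simp add: frechet_derivative_at[OF gauss_has_derivative, symmetric] hermite1_gauss)
  then have "fourier (\<lambda>t. (-1) * hermite1 t + 0 * hermite1 t) p = \<i> * complex_of_real p * fourier (gauss 0 0) p"
    using fourier_deriv[OF g, of 1 p] by simp
  moreover have "fourier (\<lambda>t. (-1) * hermite1 t + 0 * hermite1 t) = (\<lambda>p. (-1) * fourier hermite1 p + 0 * fourier hermite1 p)"
    by (rule fourier_lincomb) (use schwartz_integrable[OF hermite1_trig_schwartz[of 0]] in simp_all)
  moreover have "fourier (gauss 0 0) p = complex_of_real (sqrt (2 * pi) * exp (- p\<^sup>2 / 2))"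
    using gauss_fourier[of "- p"]
    by (simp add: fourier_def gauss_def power2_eq_square mult.commute flip: exp_of_real)
  ultimately show ?thesis
    by (simp add: hermite1_def minus_equation_iff[of "fourier hermite1 p"] mult_ac)
qed

text \<open>Inversion and Plancherel need the test function to be Schwartz, and
  \<open>represents\<close> needs its transform to be. A modulation by b translates the transform of
  \<open>hermite1\<close> by b, and this translate is again a polynomial times a Gaussian; linearity
  does the rest.\<close>

lemma hermite1_trig:
  assumes "trig T"
  shows "schwartz (\<lambda>t. hermite1 t * T t)" "schwartz (fourier (\<lambda>t. hermite1 t * T t))"
proof -
  have "schwartz (\<lambda>t. hermite1 t * T t) \<and> schwartz (fourier (\<lambda>t. hermite1 t * T t))"
    using assms
  proof induction
    case (exp b)
    let ?c = "- \<i> * complex_of_real (sqrt (2 * pi)) * complex_of_real (exp (- b\<^sup>2 / 2))"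
    have "fourier (\<lambda>t. hermite1 t * exp (\<i> * complex_of_real (t * b))) p = fourier hermite1 (p - b)" for p
      unfolding fourier_def
      by (intro Bochner_Integration.integral_cong) (simp_all add: algebra_simps exp_add exp_diff exp_minus divide_inverse)
    moreover have "hermite1 (p - b) =
        complex_of_real (exp (- b\<^sup>2 / 2)) * ((complex_of_real (p \<bullet> 1) + complex_of_real (- b)) * gauss b 0 p)" for p
    proof -
      have "exp (- (p - b)\<^sup>2 / 2) = exp (- b\<^sup>2 / 2) * exp (p * b - p * p / 2)"
        unfolding exp_add[symmetric] by (simp add: power2_eq_square field_simps)
      then show ?thesis
        by (simp add: hermite1_def gauss_def flip: exp_of_real)
    qed
    ultimately have "fourier (\<lambda>t. hermite1 t * exp (\<i> * complex_of_real (t * b))) =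
        (\<lambda>p. (?c * (complex_of_real (p \<bullet> 1) + complex_of_real (- b))) * gauss b 0 p)"
      by (auto simp: fourier_hermite1)
    moreover have "schwartz (\<lambda>p::real. (?c * (complex_of_real (p \<bullet> 1) + complex_of_real (- b))) * gauss b 0 p)"
      by (intro schwartz_poly_gauss poly_fun.intros)
    ultimately show ?case
      using hermite1_trig_schwartz by simp
  next
    case (lincomb S T a c)
    have eq: "(\<lambda>t. hermite1 t * (a * S t + c * T t)) = (\<lambda>t. a * (hermite1 t * S t) + c * (hermite1 t * T t))"
      by (simp add: algebra_simps)
    show ?case
      unfolding eq using lincomb.IH
      by (simp add: schwartz_lincomb fourier_lincomb schwartz_integrable)
  qed
  then show "schwartz (\<lambda>t. hermite1 t * T t)" "schwartz (fourier (\<lambda>t. hermite1 t * T t))"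
    by auto
qed

text \<open>G is not known to be square integrable, so Plancherel cannot be applied to it. The norm
  is recovered by duality on the sets \<open>A n\<close>, where everything is bounded, and the
  bound, uniform in n, passes to the monotone limit.\<close>

lemma line_plancherel_le:
  fixes G h :: "real \<Rightarrow> complex"
  assumes G [measurable]: "G \<in> borel_measurable borel"
    and GK: "integrable lborel (\<lambda>t. G t * hermite1 t)"
    and h: "represents h (inv_fourier_dist (fun_dist G))"
  shows "(\<integral>\<^sup>+t. ennreal ((norm (G t))\<^sup>2) \<partial>lborel) \<le> ennreal (2 * pi) * (\<integral>\<^sup>+p. ennreal ((norm (h p))\<^sup>2) \<partial>lborel)"
proof (cases "(\<integral>\<^sup>+p. ennreal ((norm (h p))\<^sup>2) \<partial>lborel) = \<infinity>")
  case True
  then show ?thesis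
    by (simp add: ennreal_mult_top)
next
  case False
  have [measurable]: "h \<in> borel_measurable borel"
    using h by (simp add: represents_def)
  have h2: "integrable lborel (\<lambda>p. (norm (h p))\<^sup>2)"
    using False by (intro integrableI_nonneg) (auto simp: top.not_eq_extremum)
  define H where "H = (\<integral>p. (norm (h p))\<^sup>2 \<partial>lborel)"
  define w where "w t = t * exp (- t\<^sup>2 / 2)" for t :: real
  have w_hermite1: "hermite1 t = complex_of_real (w t)" for t
    by (simp add: hermite1_def w_def)
  have w_norm: "(w t * norm z)\<^sup>2 = (norm (hermite1 t * z))\<^sup>2" for t z
    by (simp add: w_hermite1 norm_mult power_mult_distrib)
  have w_meas [measurable]: "w \<in> borel_measurable borel"
    unfolding w_def by measurable
  have s1: "schwartz hermite1"
    using hermite1_trig_schwartz[of 0] by simp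
  obtain M where M: "\<And>t. norm (hermite1 t) \<le> M"
    using schwartz_decay[OF s1, of 0] by auto
  have w2: "integrable lborel (\<lambda>t. (w t)\<^sup>2)"
    using integrable_norm_square_of_bounded[OF schwartz_integrable[OF s1] M] by (simp add: w_hermite1)
  have trig: "norm (\<integral>t. (G t * hermite1 t) * T t \<partial>lborel) \<le> (2 * pi * H + (\<integral>t. (w t * norm (T t))\<^sup>2 \<partial>lborel)) / 2"
    if T: "trig T" for T
  proof -
    define \<psi> where "\<psi> t = hermite1 t * T t" for t
    have \<psi>: "schwartz \<psi>" "schwartz (fourier \<psi>)"
      unfolding \<psi>_def[abs_def] using hermite1_trig[OF T] by auto
    \<comment> \<open>Testing h on \<open>fourier \<psi>\<close> makes the inverse transform on the
      other side collapse to \<psi>, so that G is paired with \<open>hermite1 * T\<close>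
      itself.\<close>
    have "(\<integral>p. h p * fourier \<psi> p \<partial>lborel) = inv_fourier_dist (fun_dist G) (fourier \<psi>)"
      and int: "integrable lborel (\<lambda>p. h p * fourier \<psi> p)"
      using h \<psi> by (auto simp: represents_def fun_dist_def)
    then have "(\<integral>p. h p * fourier \<psi> p \<partial>lborel) = (\<integral>t. (G t * hermite1 t) * T t \<partial>lborel)"
      by (simp add: inv_fourier_dist_def fourier_inversion[OF \<psi>(1)] fun_dist_def \<psi>_def mult.assoc)
    then have "norm (\<integral>t. (G t * hermite1 t) * T t \<partial>lborel) \<le> (\<integral>p. norm (h p * fourier \<psi> p) \<partial>lborel)"
      by (metis integral_norm_bound)
    \<comment> \<open>The weights of this Young inequality are chosen so that Plancherel for \<psi>
      removes the factor \<open>1 / (2 * pi)\<close>.\<close>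
    also have "\<dots> \<le> (\<integral>p. (2 * pi * (norm (h p))\<^sup>2 + (norm (fourier \<psi> p))\<^sup>2 / (2 * pi)) / 2 \<partial>lborel)"
    proof (rule integral_mono)
      show "integrable lborel (\<lambda>p. norm (h p * fourier \<psi> p))"
        using int by simp
      show "integrable lborel (\<lambda>p. (2 * pi * (norm (h p))\<^sup>2 + (norm (fourier \<psi> p))\<^sup>2 / (2 * pi)) / 2)"
        using h2 plancherel(1)[OF \<psi>(1)] by simp
      fix p
      have "0 \<le> (2 * pi * norm (h p) - norm (fourier \<psi> p))\<^sup>2 / (2 * pi)"
        by simp
      also have "\<dots> = 2 * pi * (norm (h p))\<^sup>2 + (norm (fourier \<psi> p))\<^sup>2 / (2 * pi) - 2 * (norm (h p) * norm (fourier \<psi> p))"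
        by (simp add: power2_diff power_mult_distrib field_simps power2_eq_square)
      finally show "norm (h p * fourier \<psi> p) \<le> (2 * pi * (norm (h p))\<^sup>2 + (norm (fourier \<psi> p))\<^sup>2 / (2 * pi)) / 2"
        by (simp add: norm_mult)
    qed
    also have "\<dots> = (2 * pi * H + (\<integral>p. (norm (fourier \<psi> p))\<^sup>2 \<partial>lborel) / (2 * pi)) / 2"
      using h2 plancherel(1)[OF \<psi>(1)] by (simp add: H_def)
    also have "\<dots> = (2 * pi * H + (\<integral>t. (w t * norm (T t))\<^sup>2 \<partial>lborel)) / 2"
      using plancherel(2)[OF \<psi>(1)] by (simp add: w_norm \<psi>_def)
    finally show ?thesis .
  qed
  \<comment> \<open>The three conditions bound G, keep t away from the zero of
    \<open>hermite1\<close>, and bound the Gaussian from below; together they make \<kappa> below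
    bounded.\<close>
  define A where "A n = {t. norm (G t) \<le> real n \<and> 1 \<le> real n * \<bar>t\<bar> \<and> \<bar>t\<bar> \<le> real n}" for n
  have [measurable]: "A n \<in> sets borel" for n
    unfolding A_def by measurable
  have A_le: "(\<integral>\<^sup>+t. ennreal ((norm (G t))\<^sup>2 * indicator (A n) t) \<partial>lborel) \<le> ennreal (2 * pi * H)" for n
  proof -
    let ?X = "\<integral>t. (norm (G t))\<^sup>2 * indicator (A n) t \<partial>lborel"
    \<comment> \<open>The equality case of the duality: both the pairing of \<kappa> with
      \<open>G * hermite1\<close> and the weighted square of \<kappa> are the squared modulus of G
      on \<open>A n\<close>, so that \<open>?X\<close> appears on both sides.\<close>
    define \<kappa> where "\<kappa> t = cnj (G t) / hermite1 t * indicator (A n) t" for t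
    have w_pos: "w t \<noteq> 0" if "t \<in> A n" for t
      using that by (auto simp: w_def A_def)
    have "norm (\<kappa> t) \<le> real n * (real n * exp ((real n)\<^sup>2 / 2))" for t
    proof (cases "t \<in> A n")
      case True
      then have t: "norm (G t) \<le> real n" "1 \<le> real n * \<bar>t\<bar>" "\<bar>t\<bar> \<le> real n"
        by (auto simp: A_def)
      then have "t \<noteq> 0"
        by auto
      have "inverse \<bar>t\<bar> \<le> real n"
        using t(2) \<open>t \<noteq> 0\<close> by (simp add: field_simps)
      moreover have "t\<^sup>2 \<le> (real n)\<^sup>2"
        using t(3) by (simp add: abs_le_square_iff[symmetric])
      ultimately have "inverse \<bar>t\<bar> * exp (t\<^sup>2 / 2) \<le> real n * exp ((real n)\<^sup>2 / 2)"
        by (intro mult_mono) auto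
      then have "norm (G t) * (inverse \<bar>t\<bar> * exp (t\<^sup>2 / 2)) \<le> real n * (real n * exp ((real n)\<^sup>2 / 2))"
        by (rule mult_mono[OF t(1)]) auto
      moreover have "norm (\<kappa> t) = norm (G t) * (inverse \<bar>t\<bar> * exp (t\<^sup>2 / 2))"
        using True \<open>t \<noteq> 0\<close> by (simp add: \<kappa>_def norm_divide hermite1_def norm_mult exp_minus field_simps)
      ultimately show ?thesis
        by simp
    qed (simp add: \<kappa>_def)
    moreover have "\<kappa> \<in> borel_measurable borel"
    proof -
      have [measurable]: "cnj \<in> borel_measurable borel"
        by (intro borel_measurable_continuous_onI continuous_intros)
      show ?thesis
        unfolding \<kappa>_def hermite1_def by measurable
    qed
    ultimately have "norm (\<integral>t. (G t * hermite1 t) * \<kappa> t \<partial>lborel) \<le>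
        (2 * pi * H + (\<integral>t. (w t * norm (\<kappa> t))\<^sup>2 \<partial>lborel)) / 2"
      by (intro duality_bound_extend[OF GK w_meas w2 trig])
    moreover have "(G t * hermite1 t) * \<kappa> t = complex_of_real ((norm (G t))\<^sup>2 * indicator (A n) t)" for t
      using w_pos[of t] by (auto simp: \<kappa>_def w_hermite1 complex_norm_square indicator_def simp del: of_real_power)
    moreover have "(w t * norm (\<kappa> t))\<^sup>2 = (norm (G t))\<^sup>2 * indicator (A n) t" for t
      using w_pos[of t] by (auto simp: \<kappa>_def norm_mult norm_divide w_hermite1 indicator_def power_mult_distrib power_divide)
    ultimately have "norm (complex_of_real ?X) \<le> (2 * pi * H + ?X) / 2"
      by (simp only: integral_complex_of_real)
    \<comment> \<open>Half of \<open>?X\<close> is absorbed on the left.\<close>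
    then have "?X \<le> 2 * pi * H"
      by simp
    \<comment> \<open>For a function that is not integrable \<open>?X\<close> would be the default
      value 0. Integrability is what carries the bound over to the nonnegative integral.\<close>
    moreover have "integrable lborel (\<lambda>t. (norm (G t))\<^sup>2 * indicator (A n) t)"
    proof (rule Bochner_Integration.integrable_bound)
      show "integrable lborel (\<lambda>t. (real n)\<^sup>2 * indicator {- real n..real n} t :: real)"
        by (intro integrable_mult_right integrable_real_indicator) auto
      show "AE t in lborel. norm ((norm (G t))\<^sup>2 * indicator (A n) t) \<le> norm ((real n)\<^sup>2 * indicator {- real n..real n} t)"
        by (auto simp: A_def indicator_def intro!: power_mono)
    qed measurable
    ultimately show ?thesis
      by (subst nn_integral_eq_integral) (auto intro: ennreal_leI)
  qed
  \<comment> \<open>No \<open>A n\<close> contains 0, so the increasing limit misses that one point,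
    which is a null set.\<close>
  have "(\<lambda>n. \<integral>\<^sup>+t. ennreal ((norm (G t))\<^sup>2 * indicator (A n) t) \<partial>lborel) \<longlonglongrightarrow>
      (\<integral>\<^sup>+t. ennreal ((norm (G t))\<^sup>2 * indicator (- {0}) t) \<partial>lborel)"
  proof (rule nn_integral_LIMSEQ)
    have "A m \<subseteq> A n" if "m \<le> n" for m n
    proof
      fix t assume "t \<in> A m"
      moreover have "real m * \<bar>t\<bar> \<le> real n * \<bar>t\<bar>"
        using that by (intro mult_right_mono) auto
      ultimately show "t \<in> A n"
        using that unfolding A_def by (auto intro: order_trans)
    qed
    then show "incseq (\<lambda>n t. ennreal ((norm (G t))\<^sup>2 * indicator (A n) t))"
      by (auto simp: incseq_def le_fun_def indicator_def intro!: ennreal_leI)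
    fix t
    show "(\<lambda>n. ennreal ((norm (G t))\<^sup>2 * indicator (A n) t)) \<longlonglongrightarrow> ennreal ((norm (G t))\<^sup>2 * indicator (- {0}) t)"
    proof (cases "t = 0")
      case False
      obtain n0 where n0: "max (norm (G t)) (max (inverse \<bar>t\<bar>) \<bar>t\<bar>) \<le> real n0"
        using real_arch_simple by blast
      have "t \<in> A n" if "n0 \<le> n" for n
      proof -
        have "norm (G t) \<le> real n" "inverse \<bar>t\<bar> \<le> real n" "\<bar>t\<bar> \<le> real n"
          using n0 that by (auto intro: order_trans)
        then show ?thesis
          using False by (auto simp: A_def field_simps)
      qed
      then have "\<forall>\<^sub>F n in sequentially. ennreal ((norm (G t))\<^sup>2 * indicator (- {0}) t) = ennreal ((norm (G t))\<^sup>2 * indicator (A n) t)"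
        using False by (intro eventually_sequentiallyI[of n0]) auto
      then show ?thesis
        by (rule Lim_transform_eventually[OF tendsto_const])
    qed (simp add: A_def)
  qed measurable
  then have "(\<integral>\<^sup>+t. ennreal ((norm (G t))\<^sup>2 * indicator (- {0}) t) \<partial>lborel) \<le> ennreal (2 * pi * H)"
    by (rule LIMSEQ_le_const2) (use A_le in auto)
  moreover have "(\<integral>\<^sup>+t. ennreal ((norm (G t))\<^sup>2) \<partial>lborel) = (\<integral>\<^sup>+t. ennreal ((norm (G t))\<^sup>2 * indicator (- {0}) t) \<partial>lborel)"
    by (rule nn_integral_cong_AE) (use AE_lborel_singleton[of "0::real"] in \<open>eventually_elim, auto\<close>)
  moreover have "ennreal (2 * pi * H) = ennreal (2 * pi) * (\<integral>\<^sup>+p. ennreal ((norm (h p))\<^sup>2) \<partial>lborel)"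
    using h2 by (simp add: H_def ennreal_mult nn_integral_eq_integral)
  ultimately show ?thesis
    by simp
qed

section \<open>Polar coordinates\<close>

text \<open>Lebesgue measure on \<open>real^2\<close> is the image of the one on pairs, because the
  two agree on boxes; Tonelli on pairs then applies.\<close>

lemma nn_integral_real2:
  fixes f :: "real^2 \<Rightarrow> ennreal"
  assumes [measurable]: "f \<in> borel_measurable borel"
  shows "(\<integral>\<^sup>+x. f x \<partial>lborel) = (\<integral>\<^sup>+x. \<integral>\<^sup>+y. f (vector [x, y]) \<partial>lborel \<partial>lborel)"
proof -
  define V :: "real \<times> real \<Rightarrow> real^2" where "V = (\<lambda>(x, y). x *\<^sub>R axis 1 1 + y *\<^sub>R axis 2 1)"
  have V: "V (x, y) = vector [x, y]" for x y
    by (auto simp: V_def vec_eq_iff forall_2 axis_def)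
  have [measurable]: "V \<in> borel_measurable borel"
    unfolding V_def case_prod_beta by (intro borel_measurable_continuous_onI continuous_intros)
  have "lborel = distr lborel borel V"
  proof (rule lborel_eqI)
    fix l u :: "real^2"
    assume le: "\<And>b. b \<in> Basis \<Longrightarrow> l \<bullet> b \<le> u \<bullet> b"
    have le': "l $ i \<le> u $ i" for i
      using le[of "axis i 1"] by (simp add: inner_axis)
    have "V -` box l u = box (l $ 1, l $ 2) (u $ 1, u $ 2)"
      by (auto simp: V mem_box_cart forall_2 mem_box Basis_prod_def)
    then have "emeasure (distr lborel borel V) (box l u) = emeasure lborel (box (l $ 1, l $ 2) (u $ 1, u $ 2))"
      by (simp add: emeasure_distr)
    also have "\<dots> = (u $ 1 - l $ 1) * (u $ 2 - l $ 2)"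
      using le' by (subst emeasure_lborel_box) (auto simp: Basis_prod_def prod.union_disjoint)
    also have "\<dots> = (\<Prod>b\<in>Basis. (u - l) \<bullet> b)"
      by (simp add: Basis_vec_def prod.UNION_disjoint axis_eq_axis inner_axis UNIV_2 mult.commute)
    finally show "emeasure (distr lborel borel V) (box l u) = (\<Prod>b\<in>Basis. (u - l) \<bullet> b)" .
  qed simp
  then have "(\<integral>\<^sup>+x. f x \<partial>lborel) = (\<integral>\<^sup>+x. f x \<partial>(distr lborel borel V))"
    by simp
  also have "\<dots> = (\<integral>\<^sup>+z. f (V z) \<partial>(lborel \<Otimes>\<^sub>M lborel))"
    by (simp add: nn_integral_distr lborel_prod)
  also have "\<dots> = (\<integral>\<^sup>+x. \<integral>\<^sup>+y. f (V (x, y)) \<partial>lborel \<partial>lborel)"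
    by (intro lborel.nn_integral_fst[symmetric]) (simp add: lborel_prod)
  finally show ?thesis
    by (simp add: V)
qed

text \<open>The substitution for the slope of a line through the origin, stated as an equality of
  measures: Lebesgue measure is the image under \<open>tan\<close> of the density on the open
  interval. On bounded intervals this is the fundamental theorem of calculus, and these determine
  the measure.\<close>

lemma nn_integral_tan:
  fixes f :: "real \<Rightarrow> ennreal"
  assumes [measurable]: "f \<in> borel_measurable borel"
  shows "(\<integral>\<^sup>+t. f t \<partial>lborel) =
    (\<integral>\<^sup>+\<theta>. ennreal (inverse ((cos \<theta>)\<^sup>2)) * indicator {-pi/2<..<pi/2} \<theta> * f (tan \<theta>) \<partial>lborel)"
proof -
  have tan_meas [measurable]: "(tan :: real \<Rightarrow> real) \<in> borel_measurable borel"
    unfolding tan_def[abs_def] by measurable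
  let ?g = "\<lambda>\<theta>::real. ennreal (inverse ((cos \<theta>)\<^sup>2)) * indicator {-pi/2<..<pi/2} \<theta>"
  let ?M = "distr (density lborel ?g) borel tan"
  have "lborel = ?M"
  proof (rule lborel_eqI)
    fix l u :: real
    assume "\<And>b. b \<in> Basis \<Longrightarrow> l \<bullet> b \<le> u \<bullet> b"
    then have le: "l \<le> u"
      by simp
    have iff: "\<theta> \<in> {-pi/2<..<pi/2} \<and> tan \<theta> \<in> box l u \<longleftrightarrow> \<theta> \<in> {arctan l<..<arctan u}" for \<theta>
    proof
      assume *: "\<theta> \<in> {-pi/2<..<pi/2} \<and> tan \<theta> \<in> box l u"
      then have "arctan (tan \<theta>) = \<theta>"
        by (intro arctan_tan) auto
      moreover have "l < tan \<theta>" "tan \<theta> < u"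
        using * by (auto simp: mem_box)
      ultimately show "\<theta> \<in> {arctan l<..<arctan u}"
        by (metis arctan_less_iff greaterThanLessThan_iff)
    next
      assume *: "\<theta> \<in> {arctan l<..<arctan u}"
      then have \<theta>: "- (pi / 2) < \<theta>" "\<theta> < pi / 2"
        using arctan_lbound[of l] arctan_ubound[of u] by auto
      then have "arctan (tan \<theta>) = \<theta>"
        by (intro arctan_tan) auto
      then have "l < tan \<theta>" "tan \<theta> < u"
        using * by (metis arctan_less_iff greaterThanLessThan_iff)+
      then show "\<theta> \<in> {-pi/2<..<pi/2} \<and> tan \<theta> \<in> box l u"
        using \<theta> by (auto simp: mem_box)
    qed
    have cos_pos: "cos \<theta> \<noteq> 0" if "\<theta> \<in> {arctan l..arctan u}" for \<theta>
      using cos_gt_zero_pi[of \<theta>] arctan_lbound[of l] arctan_ubound[of u] that by auto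
    have "tan -` box l u \<in> sets borel"
      using measurable_sets_borel[OF tan_meas, of "box l u"] by simp
    then have "emeasure ?M (box l u) = (\<integral>\<^sup>+\<theta>. ?g \<theta> * indicator (tan -` box l u) \<theta> \<partial>lborel)"
      by (simp add: emeasure_distr emeasure_density)
    also have "\<dots> = (\<integral>\<^sup>+\<theta>. ennreal (inverse ((cos \<theta>)\<^sup>2)) * indicator {arctan l<..<arctan u} \<theta> \<partial>lborel)"
      using iff by (intro nn_integral_cong) (auto simp: indicator_def)
    also have "\<dots> = (\<integral>\<^sup>+\<theta>. ennreal (inverse ((cos \<theta>)\<^sup>2)) * indicator {arctan l..arctan u} \<theta> \<partial>lborel)"
    proof (rule nn_integral_cong_AE)
      show "AE \<theta> in lborel. ennreal (inverse ((cos \<theta>)\<^sup>2)) * indicator {arctan l<..<arctan u} \<theta> =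
          ennreal (inverse ((cos \<theta>)\<^sup>2)) * indicator {arctan l..arctan u} \<theta>"
        using AE_lborel_singleton[of "arctan l"] AE_lborel_singleton[of "arctan u"]
        by eventually_elim (auto simp: indicator_def)
    qed
    also have "\<dots> = ennreal (tan (arctan u) - tan (arctan l))"
    proof (rule nn_integral_FTC_Icc)
      show "(tan has_real_derivative inverse ((cos \<theta>)\<^sup>2)) (at \<theta>)"
        if "\<theta> \<in> {arctan l..arctan u}" for \<theta>
        using cos_pos[OF that] by (rule DERIV_tan)
    qed (use le in \<open>auto simp: arctan_le_iff\<close>)
    finally show "emeasure ?M (box l u) = ennreal (\<Prod>b\<in>Basis. (u - l) \<bullet> b)"
      by (simp add: tan_arctan)
  qed simp
  then have "(\<integral>\<^sup>+t. f t \<partial>lborel) = (\<integral>\<^sup>+t. f t \<partial>?M)"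
    by simp
  also have "\<dots> = (\<integral>\<^sup>+\<theta>. ?g \<theta> * f (tan \<theta>) \<partial>lborel)"
    by (simp add: nn_integral_distr nn_integral_density)
  finally show ?thesis .
qed

text \<open>With lines through the origin in place of rays: substitute \<open>y = x tan \<theta>\<close> and then
  \<open>x = r cos \<theta>\<close>.\<close>

lemma nn_integral_polar:
  fixes f :: "real^2 \<Rightarrow> ennreal"
  assumes [measurable]: "f \<in> borel_measurable borel"
  shows "(\<integral>\<^sup>+x. f x \<partial>lborel) =
    (\<integral>\<^sup>+\<theta>. indicator {-pi/2<..<pi/2} \<theta> * (\<integral>\<^sup>+r. ennreal \<bar>r\<bar> * f (r *\<^sub>R circle_point \<theta>) \<partial>lborel) \<partial>lborel)"
proof -
  have vec: "vector [x, y] = x *\<^sub>R axis 1 1 + y *\<^sub>R (axis 2 1 :: real^2)" for x y :: real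
    by (auto simp: vec_eq_iff forall_2 axis_def)
  have [measurable]: "(\<lambda>(x, y). vector [x, y] :: real^2) \<in> borel_measurable (lborel \<Otimes>\<^sub>M lborel)"
    unfolding vec lborel_prod case_prod_beta
    by (simp, intro borel_measurable_continuous_onI continuous_intros)
  have "(\<integral>\<^sup>+x. f x \<partial>lborel) = (\<integral>\<^sup>+x. \<integral>\<^sup>+y. f (vector [x, y]) \<partial>lborel \<partial>lborel)"
    by (rule nn_integral_real2) fact
  also have "\<dots> = (\<integral>\<^sup>+x. \<integral>\<^sup>+t. ennreal \<bar>x\<bar> * f (vector [x, x * t]) \<partial>lborel \<partial>lborel)"
  proof (rule nn_integral_cong_AE)
    \<comment> \<open>The scaling from y to \<open>x * t\<close> degenerates at
      \<open>x = 0\<close>, a null set; elsewhere it contributes the factor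
      \<open>\<bar>x\<bar>\<close>.\<close>
    show "AE x in lborel. (\<integral>\<^sup>+y. f (vector [x, y]) \<partial>lborel) = (\<integral>\<^sup>+t. ennreal \<bar>x\<bar> * f (vector [x, x * t]) \<partial>lborel)"
      using AE_lborel_singleton[of "0::real"]
    proof eventually_elim
      case (elim x)
      then show ?case
        by (subst nn_integral_real_affine[of _ x 0]) (auto simp: nn_integral_cmult)
    qed
  qed
  also have "\<dots> = (\<integral>\<^sup>+t. \<integral>\<^sup>+x. ennreal \<bar>x\<bar> * f (vector [x, x * t]) \<partial>lborel \<partial>lborel)"
    by (rule lborel_pair.Fubini') measurable
  also have "\<dots> = (\<integral>\<^sup>+\<theta>. ennreal (inverse ((cos \<theta>)\<^sup>2)) * indicator {-pi/2<..<pi/2} \<theta> *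
      (\<integral>\<^sup>+x. ennreal \<bar>x\<bar> * f (vector [x, x * tan \<theta>]) \<partial>lborel) \<partial>lborel)"
    by (rule nn_integral_tan) measurable
  also have "\<dots> = (\<integral>\<^sup>+\<theta>. indicator {-pi/2<..<pi/2} \<theta> * (\<integral>\<^sup>+r. ennreal \<bar>r\<bar> * f (r *\<^sub>R circle_point \<theta>) \<partial>lborel) \<partial>lborel)"
  proof (rule nn_integral_cong)
    fix \<theta> :: real
    let ?c = "cos \<theta>"
    show "ennreal (inverse (?c\<^sup>2)) * indicator {-pi/2<..<pi/2} \<theta> * (\<integral>\<^sup>+x. ennreal \<bar>x\<bar> * f (vector [x, x * tan \<theta>]) \<partial>lborel) =
      indicator {-pi/2<..<pi/2} \<theta> * (\<integral>\<^sup>+r. ennreal \<bar>r\<bar> * f (r *\<^sub>R circle_point \<theta>) \<partial>lborel)"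
    proof (cases "\<theta> \<in> {-pi/2<..<pi/2}")
      case True
      then have c: "?c > 0"
        by (intro cos_gt_zero_pi) auto
      have pt: "vector [?c * r, ?c * r * tan \<theta>] = r *\<^sub>R circle_point \<theta>" for r
        using c by (auto simp: circle_point_def vec_eq_iff forall_2 tan_def)
      \<comment> \<open>One cosine comes from the substitution, the other from the factor
        \<open>\<bar>x\<bar>\<close>; together they cancel the density of \<open>tan\<close> and
        leave \<open>\<bar>r\<bar>\<close>.\<close>
      have "(\<integral>\<^sup>+x. ennreal \<bar>x\<bar> * f (vector [x, x * tan \<theta>]) \<partial>lborel) =
          ennreal ?c * (\<integral>\<^sup>+r. ennreal \<bar>?c * r\<bar> * f (r *\<^sub>R circle_point \<theta>) \<partial>lborel)"
        using c by (subst nn_integral_real_affine[of _ ?c 0]) (auto simp: pt)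
      also have "ennreal ?c * (\<integral>\<^sup>+r. ennreal \<bar>?c * r\<bar> * f (r *\<^sub>R circle_point \<theta>) \<partial>lborel) = ennreal ?c * (ennreal ?c * (\<integral>\<^sup>+r. ennreal \<bar>r\<bar> * f (r *\<^sub>R circle_point \<theta>) \<partial>lborel))"
        using c by (simp add: abs_mult ennreal_mult mult.assoc nn_integral_cmult)
      finally have "(\<integral>\<^sup>+x. ennreal \<bar>x\<bar> * f (vector [x, x * tan \<theta>]) \<partial>lborel) =
          ennreal ?c * (ennreal ?c * (\<integral>\<^sup>+r. ennreal \<bar>r\<bar> * f (r *\<^sub>R circle_point \<theta>) \<partial>lborel))" .
      moreover have "inverse ?c * inverse ?c * ?c * ?c = 1"
        using c by (simp add: field_simps)
      ultimately show ?thesis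
        using True c by (simp add: mult.assoc[symmetric] ennreal_mult[symmetric] power2_eq_square)
    qed simp
  qed
  finally show ?thesis .
qed

section \<open>The estimate\<close>

lemma ennreal_sqrt_mono: "a \<le> b \<Longrightarrow> ennreal_sqrt a \<le> ennreal_sqrt b"
  by (auto simp: ennreal_sqrt_def top_unique top.not_eq_extremum intro!: ennreal_leI enn2real_mono)

section \<open>The circle, its arclength measure and the cone\<close>

lemma continuous_on_circle_point: "continuous_on S circle_point"
proof -
  have "circle_point = (\<lambda>\<theta>. cos \<theta> *\<^sub>R axis 1 1 + sin \<theta> *\<^sub>R axis 2 1)"
    by (auto simp: circle_point_def vec_eq_iff forall_2 axis_def)
  then show ?thesis
    by (rule ssubst) (intro continuous_intros)
qed

lemma circle_point_measurable [measurable]: "circle_point \<in> borel_measurable borel"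
  by (rule borel_measurable_continuous_onI[OF continuous_on_circle_point])

lemma norm_circle_point [simp]: "norm (circle_point \<theta>) = 1"
  by (simp add: circle_point_def norm_vec_def L2_set_def sum_2)

lemma circle_point_arclength_measurable:
  "circle_point \<in> measurable (restrict_space lborel A) (restrict_space borel (sphere 0 1))"
  by (intro measurable_restrict_space3) auto

lemma nn_integral_arclength:
  assumes "f \<in> borel_measurable arclength"
  shows "(\<integral>\<^sup>+v. f v \<partial>arclength) = (\<integral>\<^sup>+\<theta>. f (circle_point \<theta>) * indicator {-pi<..pi} \<theta> \<partial>lborel)"
proof -
  have "f \<in> borel_measurable (restrict_space borel (sphere 0 1))"
    using assms by (simp add: arclength_def)
  then show ?thesis
    unfolding arclength_def
    by (subst nn_integral_distr[OF circle_point_arclength_measurable])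
      (simp_all add: nn_integral_restrict_space)
qed

lemma AE_arclengthD:
  assumes "AE v in arclength. P v"
  shows "AE \<theta> in lborel. \<theta> \<in> {-pi<..pi} \<longrightarrow> P (circle_point \<theta>)"
  using AE_distrD[OF circle_point_arclength_measurable assms[unfolded arclength_def]]
  by (simp add: AE_restrict_space_iff)

lemma finite_measure_arclength: "finite_measure arclength"
proof
  have "emeasure arclength (space arclength) = (\<integral>\<^sup>+v. 1 \<partial>arclength)"
    by simp
  also have "\<dots> = (\<integral>\<^sup>+\<theta>. indicator {-pi<..pi} \<theta> \<partial>lborel)"
    by (subst nn_integral_arclength) auto
  also have "\<dots> \<noteq> \<infinity>"
    by simp
  finally show "emeasure arclength (space arclength) \<noteq> \<infinity>" .
qed

lemma arc_borel: "arc \<delta> \<in> sets borel"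
  unfolding arc_def
  by (intro borel_compact compact_continuous_image continuous_on_circle_point compact_Icc)

lemma angular_cone_borel: "angular_cone \<delta> \<in> sets borel"
proof -
  have "(\<lambda>\<xi>::real^2. \<xi> /\<^sub>R norm \<xi>) -` arc \<delta> \<in> sets borel"
    using arc_borel by (intro measurable_sets_borel[OF _ arc_borel]) measurable
  moreover have "angular_cone \<delta> = (\<lambda>\<xi>. \<xi> /\<^sub>R norm \<xi>) -` arc \<delta> - {0}"
    by (auto simp: angular_cone_def)
  ultimately show ?thesis
    by auto
qed

text \<open>The lines through the angles of the open right half circle meet the cone only in rays
  pointing to the right, because \<open>\<delta> \<le> pi / 2\<close>.\<close>

lemma scaleR_circle_point_angular_cone:
  assumes "\<delta> \<le> pi / 2" "\<theta> \<in> {-pi/2<..<pi/2}" "r *\<^sub>R circle_point \<theta> \<in> angular_cone \<delta>"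
  shows "circle_point \<theta> \<in> arc \<delta>"
proof -
  have r: "r \<noteq> 0" and mem: "(r / \<bar>r\<bar>) *\<^sub>R circle_point \<theta> \<in> arc \<delta>"
    using assms(3) by (auto simp: angular_cone_def divide_inverse_commute)
  show ?thesis
  proof (cases "r > 0")
    case True
    then show ?thesis
      using mem by simp
  next
    case False
    then have "- circle_point \<theta> \<in> arc \<delta>"
      using mem r by simp
    then obtain \<eta> where \<eta>: "- \<delta> \<le> \<eta>" "\<eta> \<le> \<delta>" "- circle_point \<theta> = circle_point \<eta>"
      by (auto simp: arc_def)
    have "- cos \<theta> = cos \<eta>"
      using arg_cong[OF \<eta>(3), of "\<lambda>v. v $ 1"] by (simp add: circle_point_def)
    moreover have "cos \<eta> \<ge> 0"
      using \<eta> assms(1) by (intro cos_ge_zero) auto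
    moreover have "cos \<theta> > 0"
      using assms(2) by (intro cos_gt_zero_pi) auto
    ultimately show ?thesis
      by linarith
  qed
qed

text \<open>The infimum over the empty set is \<infinity>, so a finite Sobolev norm forces a
  representative to exist. The choice in \<open>fourier_fun\<close> can then be satisfied whether or
  not there is a continuous one.\<close>

lemma represents_fourier_fun:
  assumes "f \<in> sobolev_space s"
  shows "represents (fourier_fun f) (fourier_dist f)"
proof -
  let ?P = "\<lambda>g. represents g (fourier_dist f) \<and>
     ((\<exists>c. continuous_on UNIV c \<and> represents c (fourier_dist f)) \<longrightarrow> continuous_on UNIV g)"
  have "{g. represents g (fourier_dist f)} \<noteq> {}"
  proof
    assume "{g. represents g (fourier_dist f)} = {}"
    then have "sobolev_norm s f = \<infinity>"
      unfolding sobolev_norm_def by (simp only: image_empty Inf_empty infinity_ennreal_def)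
    then show False
      using assms by (simp add: sobolev_space_def)
  qed
  then have "\<exists>g. ?P g"
    by blast
  then have "?P (fourier_fun f)"
    unfolding fourier_fun_def by (rule someI_ex)
  then show ?thesis
    by simp
qed

text \<open>On a Schwartz function the inverse transform inside the multiplier cancels the outer
  Fourier transform, and multiplication by an indicator preserves absolute convergence.\<close>

lemma represents_fourier_multiplier:
  assumes F: "represents (fourier_fun f) (fourier_dist f)" and A: "A \<in> sets borel"
  shows "represents (\<lambda>\<xi>. indicator A \<xi> * fourier_fun f \<xi>) (fourier_dist (fourier_multiplier (indicator A) f))"
  unfolding represents_def
proof (intro conjI allI impI)
  have [measurable]: "fourier_fun f \<in> borel_measurable borel"
    using F by (simp add: represents_def)
  show meas: "(\<lambda>\<xi>. indicator A \<xi> * fourier_fun f \<xi>) \<in> borel_measurable borel"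
    using A by measurable
  fix \<phi> :: "'a \<Rightarrow> complex" assume \<phi>: "schwartz \<phi>"
  have [measurable]: "\<phi> \<in> borel_measurable borel"
    using \<phi> by (rule schwartz_measurable)
  show "integrable lborel (\<lambda>\<xi>. indicator A \<xi> * fourier_fun f \<xi> * \<phi> \<xi>)"
  proof (rule Bochner_Integration.integrable_bound)
    show "integrable lborel (\<lambda>\<xi>. fourier_fun f \<xi> * \<phi> \<xi>)"
      using F \<phi> by (simp add: represents_def)
    show "(\<lambda>\<xi>. indicator A \<xi> * fourier_fun f \<xi> * \<phi> \<xi>) \<in> borel_measurable lborel"
      using meas by measurable
  qed (auto simp: norm_mult indicator_def)
  show "fourier_dist (fourier_multiplier (indicator A) f) \<phi> = fun_dist (\<lambda>\<xi>. indicator A \<xi> * fourier_fun f \<xi>) \<phi>"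
    by (simp add: fourier_dist_def fourier_multiplier_def inv_fourier_dist_def fourier_inversion[OF \<phi>])
qed

theorem theorem3p1:
  fixes \<delta> :: real and f :: "(real^2) distribution"
  assumes "0 < \<delta>" and "\<delta> \<le> pi / 2"
    and "f \<in> sobolev_space (- 1 / 2)"
    and "dist_support f \<subseteq> ball 0 1"
  shows "sobolev_norm (- 1 / 2) (fourier_multiplier (indicator (angular_cone \<delta>)) f)
           \<le> L2_norm_line_circle (limited_radon \<delta> f)"
proof -
  \<comment> \<open>One and the same function enters the multiplier and, through its values on
    lines, the Radon transform. This makes its restriction to a line unambiguous although lines are
    null sets of the plane.\<close>
  define F where "F = fourier_fun f"
  define m :: "real^2 \<Rightarrow> complex" where "m = indicator (angular_cone \<delta>)"
  let ?I = "{-pi/2<..<pi/2} :: real set"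
  have F: "represents F (fourier_dist f)"
    unfolding F_def using assms(3) by (rule represents_fourier_fun)
  then have F_meas [measurable]: "F \<in> borel_measurable borel"
    by (simp add: represents_def)
  have [measurable]: "m \<in> borel_measurable borel"
    unfolding m_def using angular_cone_borel by measurable
  note [measurable] = arc_borel
  define L where "L = (\<integral>\<^sup>+\<xi>. ennreal ((1 + (norm \<xi>)\<^sup>2) powr (- 1 / 2) * (norm (m \<xi> * F \<xi>))\<^sup>2) \<partial>lborel)"
  define line where "line \<theta> = (\<integral>\<^sup>+r. ennreal ((norm (F (r *\<^sub>R circle_point \<theta>)))\<^sup>2) \<partial>lborel)" for \<theta>
  have "L = (\<integral>\<^sup>+\<theta>. indicator ?I \<theta> * (\<integral>\<^sup>+r. ennreal \<bar>r\<bar> * ennreal ((1 + (norm (r *\<^sub>R circle_point \<theta>))\<^sup>2) powr (- 1 / 2) *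
      (norm (m (r *\<^sub>R circle_point \<theta>) * F (r *\<^sub>R circle_point \<theta>)))\<^sup>2) \<partial>lborel) \<partial>lborel)"
    unfolding L_def by (rule nn_integral_polar) measurable
  also have "\<dots> \<le> (\<integral>\<^sup>+\<theta>. indicator ?I \<theta> * indicator (arc \<delta>) (circle_point \<theta>) * line \<theta> \<partial>lborel)"
  proof (rule nn_integral_mono)
    fix \<theta> :: real
    have "ennreal \<bar>r\<bar> * ennreal ((1 + (norm (r *\<^sub>R circle_point \<theta>))\<^sup>2) powr (- 1 / 2) *
        (norm (m (r *\<^sub>R circle_point \<theta>) * F (r *\<^sub>R circle_point \<theta>)))\<^sup>2) \<le>
        indicator (arc \<delta>) (circle_point \<theta>) * ennreal ((norm (F (r *\<^sub>R circle_point \<theta>)))\<^sup>2)"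
      if \<theta>: "\<theta> \<in> ?I" for r
    proof (cases "r *\<^sub>R circle_point \<theta> \<in> angular_cone \<delta>")
      case True
      then have arc: "circle_point \<theta> \<in> arc \<delta>"
        using assms(2) \<theta> scaleR_circle_point_angular_cone by blast
      have "\<bar>r\<bar> \<le> sqrt (1 + r\<^sup>2)"
        by (rule real_le_rsqrt) simp
      then have "\<bar>r\<bar> * (1 + r\<^sup>2) powr (- 1 / 2) \<le> 1"
        by (simp add: powr_minus powr_half_sqrt divide_inverse[symmetric] divide_le_eq_1 add_pos_nonneg)
      then have "\<bar>r\<bar> * (1 + r\<^sup>2) powr (- 1 / 2) * (norm (F (r *\<^sub>R circle_point \<theta>)))\<^sup>2 \<le> 1 * (norm (F (r *\<^sub>R circle_point \<theta>)))\<^sup>2"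
        by (intro mult_right_mono) auto
      then show ?thesis
        using True arc by (simp add: m_def ennreal_mult[symmetric] ennreal_leI mult.assoc del: minus_divide_left)
    qed (simp add: m_def)
    then have "(\<integral>\<^sup>+r. ennreal \<bar>r\<bar> * ennreal ((1 + (norm (r *\<^sub>R circle_point \<theta>))\<^sup>2) powr (- 1 / 2) *
        (norm (m (r *\<^sub>R circle_point \<theta>) * F (r *\<^sub>R circle_point \<theta>)))\<^sup>2) \<partial>lborel) \<le>
        (\<integral>\<^sup>+r. indicator (arc \<delta>) (circle_point \<theta>) * ennreal ((norm (F (r *\<^sub>R circle_point \<theta>)))\<^sup>2) \<partial>lborel)"
      if "\<theta> \<in> ?I"
      using that by (intro nn_integral_mono)
    then show "indicator ?I \<theta> * (\<integral>\<^sup>+r. ennreal \<bar>r\<bar> * ennreal ((1 + (norm (r *\<^sub>R circle_point \<theta>))\<^sup>2) powr (- 1 / 2) *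
        (norm (m (r *\<^sub>R circle_point \<theta>) * F (r *\<^sub>R circle_point \<theta>)))\<^sup>2) \<partial>lborel) \<le>
        indicator ?I \<theta> * indicator (arc \<delta>) (circle_point \<theta>) * line \<theta>"
      by (cases "\<theta> \<in> ?I") (auto simp: line_def nn_integral_cmult)
  qed
  finally have L_le: "L \<le> (\<integral>\<^sup>+\<theta>. indicator ?I \<theta> * indicator (arc \<delta>) (circle_point \<theta>) * line \<theta> \<partial>lborel)" .

  \<comment> \<open>F paired with the Gaussian of the plane converges absolutely. In polar
    coordinates the Jacobian times this Gaussian is the modulus of \<open>hermite1\<close>, and an
    integral over angles that is finite has a finite integrand almost everywhere.\<close>
  have int: "AE \<theta> in lborel. \<theta> \<in> ?I \<longrightarrow> integrable lborel (\<lambda>r. F (r *\<^sub>R circle_point \<theta>) * hermite1 r)"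
  proof -
    have g: "schwartz (gauss 0 (0::real^2))"
      using schwartz_poly_gauss[OF poly_fun.const[of 1], of 0 "0::real^2"] by simp
    have [measurable]: "gauss 0 (0::real^2) \<in> borel_measurable borel"
      using g by (rule schwartz_measurable)
    have [measurable]: "hermite1 \<in> borel_measurable borel"
      unfolding hermite1_def[abs_def] by measurable
    have "integrable lborel (\<lambda>\<xi>. F \<xi> * gauss 0 0 \<xi>)"
      using F g by (simp add: represents_def)
    then have "(\<integral>\<^sup>+\<xi>. ennreal (norm (F \<xi> * gauss 0 0 \<xi>)) \<partial>lborel) < \<infinity>"
      by (simp add: integrable_iff_bounded)
    moreover have "(\<integral>\<^sup>+\<xi>. ennreal (norm (F \<xi> * gauss 0 0 \<xi>)) \<partial>lborel) =
       (\<integral>\<^sup>+\<theta>. indicator ?I \<theta> * (\<integral>\<^sup>+r. ennreal \<bar>r\<bar> *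
          ennreal (norm (F (r *\<^sub>R circle_point \<theta>) * gauss 0 0 (r *\<^sub>R circle_point \<theta>))) \<partial>lborel) \<partial>lborel)"
      by (rule nn_integral_polar) measurable
    moreover have "\<dots> = (\<integral>\<^sup>+\<theta>. indicator ?I \<theta> * (\<integral>\<^sup>+r. ennreal (norm (F (r *\<^sub>R circle_point \<theta>) * hermite1 r)) \<partial>lborel) \<partial>lborel)"
      by (intro nn_integral_cong arg_cong2[where f="(*)"] refl)
        (simp add: norm_mult norm_gauss hermite1_def ennreal_mult[symmetric] mult_ac)
    ultimately have "(\<integral>\<^sup>+\<theta>. indicator ?I \<theta> * (\<integral>\<^sup>+r. ennreal (norm (F (r *\<^sub>R circle_point \<theta>) * hermite1 r)) \<partial>lborel) \<partial>lborel) \<noteq> \<infinity>"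
      by simp
    then have "AE \<theta> in lborel. indicator ?I \<theta> * (\<integral>\<^sup>+r. ennreal (norm (F (r *\<^sub>R circle_point \<theta>) * hermite1 r)) \<partial>lborel) \<noteq> \<infinity>"
      by (intro nn_integral_PInf_AE) measurable
    then show ?thesis
    proof eventually_elim
      case (elim \<theta>)
      show ?case
      proof
        assume "\<theta> \<in> ?I"
        with elim show "integrable lborel (\<lambda>r. F (r *\<^sub>R circle_point \<theta>) * hermite1 r)"
          by (intro integrableI_bounded) (simp_all add: top.not_eq_extremum)
      qed
    qed
  qed

  \<comment> \<open>The right-hand norm is an infimum, so an arbitrary competitor h has to be
    estimated.\<close>
  have main: "ennreal (1 / (2 * pi) ^ DIM(real^2)) * L \<le> (\<integral>\<^sup>+z. ennreal ((norm (h z))\<^sup>2) \<partial>(lborel \<Otimes>\<^sub>M arclength))"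
    if h [measurable]: "h \<in> borel_measurable (lborel \<Otimes>\<^sub>M arclength)"
      and rep: "AE v in arclength. represents (\<lambda>p. h (p, v)) (limited_radon \<delta> f v)" for h
  proof -
    interpret arclength: finite_measure arclength
      by (rule finite_measure_arclength)
    interpret pair_sigma_finite lborel arclength ..
    define k where "k v = (\<integral>\<^sup>+p. ennreal ((norm (h (p, v)))\<^sup>2) \<partial>lborel)" for v
    have k_meas: "k \<in> borel_measurable arclength"
      unfolding k_def by measurable
    \<comment> \<open>A line through the origin other than the vertical one has a single angle in
      \<open>?I\<close>, while the circle contains both of its unit vectors. Since k is nonnegative,
      passing to the full circle only enlarges the right-hand side.\<close>
    have "(\<integral>\<^sup>+\<theta>. indicator ?I \<theta> * indicator (arc \<delta>) (circle_point \<theta>) * line \<theta> \<partial>lborel) \<le>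
        (\<integral>\<^sup>+\<theta>. ennreal (2 * pi) * (k (circle_point \<theta>) * indicator {-pi<..pi} \<theta>) \<partial>lborel)"
    proof (rule nn_integral_mono_AE)
      show "AE \<theta> in lborel. indicator ?I \<theta> * indicator (arc \<delta>) (circle_point \<theta>) * line \<theta> \<le>
          ennreal (2 * pi) * (k (circle_point \<theta>) * indicator {-pi<..pi} \<theta>)"
        using int AE_arclengthD[OF rep]
      proof eventually_elim
        case (elim \<theta>)
        show ?case
        proof (cases "\<theta> \<in> ?I \<and> circle_point \<theta> \<in> arc \<delta>")
          case True
          then have \<theta>: "\<theta> \<in> {-pi<..pi}"
            by auto
          then have "represents (\<lambda>p. h (p, circle_point \<theta>)) (inv_fourier_dist (fun_dist (\<lambda>\<tau>. F (\<tau> *\<^sub>R circle_point \<theta>))))"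
            using elim True by (simp add: limited_radon_def F_def)
          then have "line \<theta> \<le> ennreal (2 * pi) * k (circle_point \<theta>)"
            unfolding line_def k_def using elim True
            by (intro line_plancherel_le) auto
          then show ?thesis
            using True \<theta> by simp
        qed auto
      qed
    qed
    also have "\<dots> = (\<integral>\<^sup>+v. ennreal (2 * pi) * k v \<partial>arclength)"
      using k_meas by (subst nn_integral_arclength) (auto simp: mult.assoc)
    also have "\<dots> = ennreal (2 * pi) * (\<integral>\<^sup>+v. k v \<partial>arclength)"
      using k_meas by (rule nn_integral_cmult)
    also have "(\<integral>\<^sup>+v. k v \<partial>arclength) = (\<integral>\<^sup>+z. ennreal ((norm (h z))\<^sup>2) \<partial>(lborel \<Otimes>\<^sub>M arclength))"
      unfolding k_def by (rule nn_integral_snd) measurable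
    finally have "L \<le> ennreal (2 * pi) * (\<integral>\<^sup>+z. ennreal ((norm (h z))\<^sup>2) \<partial>(lborel \<Otimes>\<^sub>M arclength))"
      using L_le by simp
    then have "ennreal (1 / (2 * pi) ^ DIM(real^2)) * L \<le>
        ennreal (1 / (2 * pi) ^ DIM(real^2)) * (ennreal (2 * pi) * (\<integral>\<^sup>+z. ennreal ((norm (h z))\<^sup>2) \<partial>(lborel \<Otimes>\<^sub>M arclength)))"
      by (rule mult_left_mono) simp
    also have "\<dots> = ennreal (1 / (2 * pi)) * (\<integral>\<^sup>+z. ennreal ((norm (h z))\<^sup>2) \<partial>(lborel \<Otimes>\<^sub>M arclength))"
      by (simp add: mult.assoc[symmetric] ennreal_mult[symmetric] power2_eq_square)
    also have "\<dots> \<le> 1 * (\<integral>\<^sup>+z. ennreal ((norm (h z))\<^sup>2) \<partial>(lborel \<Otimes>\<^sub>M arclength))"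
      using pi_ge_two by (intro mult_right_mono) (auto simp: ennreal_le_1)
    finally show ?thesis
      by simp
  qed

  \<comment> \<open>An upper bound for the infimum on the left needs just one representative, the
    indicator of the cone times F.\<close>
  have "sobolev_norm (- 1 / 2) (fourier_multiplier (indicator (angular_cone \<delta>)) f) \<le>
      ennreal_sqrt (ennreal (1 / (2 * pi) ^ DIM(real^2)) * L)"
    unfolding sobolev_norm_def L_def m_def F_def
    by (intro INF_lower) (use represents_fourier_multiplier[OF F[unfolded F_def] angular_cone_borel] in simp)
  also have "\<dots> \<le> L2_norm_line_circle (limited_radon \<delta> f)"
    unfolding L2_norm_line_circle_def
    by (intro INF_greatest ennreal_sqrt_mono) (use main in auto)
  finally show ?thesis .
qed

end
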